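(* Let $H$ and $K$ be Hilbert $\mathfrak{A}$-modules over a $C^*$-algebra $\mathfrak{A}$. Suppose that $T\in\mathcal{L}(K)$ and $S\in\mathcal{L}(H)$ have the polar decompositions $T=U_T|T|$ and $S=U_S|S|$. For every $A\in\mathcal{L}(H,K)$, put $X=TAS$ and $Y=|T|\cdot A\cdot |S^*|$ (both in $\mathcal{L}(H,K)$). Then the following statements are valid: (i) If $X=U_X|X|$ is the polar decomposition of $X$, then $Y=U_T^*U_XU_S^*|Y|$ is the polar decomposition of $Y$; (ii) If $Y=U_Y|Y|$ is the polar decomposition of $Y$, then $X=U_TU_YU_S|X|$ is the polar decomposition of $X$.
   Context: $\mathcal{L}(H,K)$ denotes the set of adjointable operators from $H$ to $K$, and $\mathcal{L}(H)=\mathcal{L}(H,H)$. For an adjointable operator $B$, $|B|=(B^*B)^{1/2}$, and $\mathcal{R}(B)$ is its range. A closed submodule $M$ of $H$ is orthogonally complemented if $H=M\dotplus M^\perp$, and then $P_M$ is the projection of $H$ onto $M$. An operator $U\in\mathcal{L}(H,K)$ is a partial isometry if $U^*U$ is a projection (self-adjoint idempotent). Polar decomposition: for $B\in\mathcal{L}(H,K)$, "$B=U|B|$ is the polar decomposition" (or "$B$ has the polar decomposition $B=U|B|$") means that $U\in\mathcal{L}(H,K)$ is a partial isometry such that $B=U|B|$ and $U^*U=P_{\overline{\mathcal{R}(B^* )}}$ (in particular $\overline{\mathcal{R}(B^* )}$ is orthogonally complemented in $H$). Such a $U$ is unique if it exists, but it need not exist in general. *)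

theory Defs
  imports "HOL-Analysis.Analysis"
begin

section \<open>\<open>C\<^sup>*\<close>-algebras\<close>

class complex_banach = banach +
  fixes scaleC :: "complex \<Rightarrow> 'a \<Rightarrow> 'a"  (infixr "*\<^sub>C" 75)
  assumes scaleC_add_right: "c *\<^sub>C (x + y) = c *\<^sub>C x + c *\<^sub>C y"
    and scaleC_add_left: "(c + d) *\<^sub>C x = c *\<^sub>C x + d *\<^sub>C x"
    and scaleC_scaleC: "c *\<^sub>C d *\<^sub>C x = (c * d) *\<^sub>C x"
    and scaleC_one: "1 *\<^sub>C x = x"
    and scaleR_scaleC: "scaleR r x = complex_of_real r *\<^sub>C x"
    and norm_scaleC: "norm (c *\<^sub>C x) = cmod c * norm x"

text \<open>No unit is assumed.\<close>

class cstar_algebra = complex_banach + real_normed_algebra +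
  fixes star :: "'a \<Rightarrow> 'a"
  assumes mult_scaleC_left: "(c *\<^sub>C a) * b = c *\<^sub>C (a * b)"
    and mult_scaleC_right: "a * (c *\<^sub>C b) = c *\<^sub>C (a * b)"
    and star_add: "star (a + b) = star a + star b"
    and star_scaleC: "star (c *\<^sub>C a) = cnj c *\<^sub>C star a"
    and star_mult: "star (a * b) = star b * star a"
    and star_star: "star (star a) = a"
    and cstar_identity: "norm (star a * a) = (norm a)\<^sup>2"

text \<open>
  The spectrum of \<open>a\<close> is taken in the unitization: for \<open>c \<noteq> 0\<close> and \<open>x = c\<^sup>-\<^sup>1 a\<close>, the element
  \<open>c 1 - a = c (1 - x)\<close> is invertible there iff \<open>(1 - x) (1 - y) = 1 = (1 - y) (1 - x)\<close> for some
  \<open>y\<close> in the algebra. If the algebra is unital, this differs from the usual spectrum at most by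
  the point \<open>0\<close>, which does not matter for positivity.
\<close>

definition quasi_invertible :: "'a::cstar_algebra \<Rightarrow> bool" where
  "quasi_invertible x \<longleftrightarrow> (\<exists>y. x + y - x * y = 0 \<and> x + y - y * x = 0)"

definition cstar_spectrum :: "'a::cstar_algebra \<Rightarrow> complex set" where
  "cstar_spectrum a = {c. c = 0 \<or> \<not> quasi_invertible (inverse c *\<^sub>C a)}"

definition cstar_positive :: "'a::cstar_algebra \<Rightarrow> bool" where
  "cstar_positive a \<longleftrightarrow> star a = a \<and> cstar_spectrum a \<subseteq> \<real>\<^sub>\<ge>\<^sub>0"


section \<open>Hilbert \<open>C\<^sup>*\<close>-modules\<close>

text \<open>
  Right modules, with inner product conjugate-linear in the first and linear in the second
  argument. The carrier is the whole type \<open>'h\<close>. Its norm is required to be the one induced by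
  the inner product, so that completeness is that of the type class and closures are those of
  the library.
\<close>

record ('h, 'a) hmodule =
  act :: "'h \<Rightarrow> 'a \<Rightarrow> 'h"
  ip :: "'h \<Rightarrow> 'h \<Rightarrow> 'a"

locale hilbert_module =
  fixes H :: "('h::complex_banach, 'a::cstar_algebra) hmodule"
  assumes act_add_left: "act H (x + y) a = act H x a + act H y a"
    and act_add_right: "act H x (a + b) = act H x a + act H x b"
    and act_mult: "act H x (a * b) = act H (act H x a) b"
    and act_scaleC_left: "act H (c *\<^sub>C x) a = c *\<^sub>C act H x a"
    and act_scaleC_right: "act H x (c *\<^sub>C a) = c *\<^sub>C act H x a"
    and ip_add_right: "ip H x (y + z) = ip H x y + ip H x z"
    and ip_scaleC_right: "ip H x (c *\<^sub>C y) = c *\<^sub>C ip H x y"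
    and ip_act_right: "ip H x (act H y a) = ip H x y * a"
    and ip_star: "star (ip H x y) = ip H y x"
    and ip_positive: "cstar_positive (ip H x x)"
    and ip_definite: "ip H x x = 0 \<Longrightarrow> x = 0"
    and norm_ip: "norm x = sqrt (norm (ip H x x))"


section \<open>Adjointable operators\<close>

text \<open>Linearity and boundedness are consequences of having an adjoint.\<close>

definition is_adjoint ::
  "('h::complex_banach, 'a::cstar_algebra) hmodule \<Rightarrow> ('k::complex_banach, 'a) hmodule
    \<Rightarrow> ('h \<Rightarrow> 'k) \<Rightarrow> ('k \<Rightarrow> 'h) \<Rightarrow> bool" where
  "is_adjoint H K T T' \<longleftrightarrow> (\<forall>x y. ip K (T x) y = ip H x (T' y))"

definition adjointable ::
  "('h::complex_banach, 'a::cstar_algebra) hmodule \<Rightarrow> ('k::complex_banach, 'a) hmodule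
    \<Rightarrow> ('h \<Rightarrow> 'k) set" where
  "adjointable H K = {T. \<exists>T'. is_adjoint H K T T'}"

definition adj ::
  "('h::complex_banach, 'a::cstar_algebra) hmodule \<Rightarrow> ('k::complex_banach, 'a) hmodule
    \<Rightarrow> ('h \<Rightarrow> 'k) \<Rightarrow> 'k \<Rightarrow> 'h" where
  "adj H K T = (THE T'. is_adjoint H K T T')"

text \<open>Spectrum and positivity in the unital algebra of adjointable operators on \<open>H\<close>.\<close>

definition op_spectrum ::
  "('h::complex_banach, 'a::cstar_algebra) hmodule \<Rightarrow> ('h \<Rightarrow> 'h) \<Rightarrow> complex set" where
  "op_spectrum H T =
    {c. \<not> (\<exists>V \<in> adjointable H H. V \<circ> (\<lambda>x. T x - c *\<^sub>C x) = id \<and> (\<lambda>x. T x - c *\<^sub>C x) \<circ> V = id)}"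

definition op_positive ::
  "('h::complex_banach, 'a::cstar_algebra) hmodule \<Rightarrow> ('h \<Rightarrow> 'h) \<Rightarrow> bool" where
  "op_positive H T \<longleftrightarrow> T \<in> adjointable H H \<and> adj H H T = T \<and> op_spectrum H T \<subseteq> \<real>\<^sub>\<ge>\<^sub>0"

definition op_sqrt ::
  "('h::complex_banach, 'a::cstar_algebra) hmodule \<Rightarrow> ('h \<Rightarrow> 'h) \<Rightarrow> 'h \<Rightarrow> 'h" where
  "op_sqrt H T = (THE R. op_positive H R \<and> R \<circ> R = T)"

definition op_abs ::
  "('h::complex_banach, 'a::cstar_algebra) hmodule \<Rightarrow> ('k::complex_banach, 'a) hmodule
    \<Rightarrow> ('h \<Rightarrow> 'k) \<Rightarrow> 'h \<Rightarrow> 'h" where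
  "op_abs H K B = op_sqrt H (adj H K B \<circ> B)"


section \<open>Orthogonal complements and polar decompositions\<close>

definition closed_submodule ::
  "('h::complex_banach, 'a::cstar_algebra) hmodule \<Rightarrow> 'h set \<Rightarrow> bool" where
  "closed_submodule H M \<longleftrightarrow> closed M \<and> 0 \<in> M \<and> (\<forall>x\<in>M. \<forall>y\<in>M. x + y \<in> M)
    \<and> (\<forall>c. \<forall>x\<in>M. c *\<^sub>C x \<in> M) \<and> (\<forall>a. \<forall>x\<in>M. act H x a \<in> M)"

definition orth_compl ::
  "('h::complex_banach, 'a::cstar_algebra) hmodule \<Rightarrow> 'h set \<Rightarrow> 'h set" where
  "orth_compl H M = {x. \<forall>y\<in>M. ip H x y = 0}"

definition orthogonally_complemented ::
  "('h::complex_banach, 'a::cstar_algebra) hmodule \<Rightarrow> 'h set \<Rightarrow> bool" where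
  "orthogonally_complemented H M \<longleftrightarrow> closed_submodule H M
    \<and> M \<inter> orth_compl H M = {0} \<and> (\<forall>x. \<exists>y\<in>M. \<exists>z\<in>orth_compl H M. x = y + z)"

text \<open>Only meaningful if \<open>M\<close> is orthogonally complemented.\<close>

definition proj ::
  "('h::complex_banach, 'a::cstar_algebra) hmodule \<Rightarrow> 'h set \<Rightarrow> 'h \<Rightarrow> 'h" where
  "proj H M x = (THE y. y \<in> M \<and> x - y \<in> orth_compl H M)"

definition is_projection ::
  "('h::complex_banach, 'a::cstar_algebra) hmodule \<Rightarrow> ('h \<Rightarrow> 'h) \<Rightarrow> bool" where
  "is_projection H P \<longleftrightarrow> P \<in> adjointable H H \<and> adj H H P = P \<and> P \<circ> P = P"

definition partial_isometry ::
  "('h::complex_banach, 'a::cstar_algebra) hmodule \<Rightarrow> ('k::complex_banach, 'a) hmodule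
    \<Rightarrow> ('h \<Rightarrow> 'k) \<Rightarrow> bool" where
  "partial_isometry H K U \<longleftrightarrow> U \<in> adjointable H K \<and> is_projection H (adj H K U \<circ> U)"

text \<open>\<open>polar_decomposition H K B U\<close>: ``\<open>B = U |B|\<close> is the polar decomposition of \<open>B\<close>''.\<close>

definition polar_decomposition ::
  "('h::complex_banach, 'a::cstar_algebra) hmodule \<Rightarrow> ('k::complex_banach, 'a) hmodule
    \<Rightarrow> ('h \<Rightarrow> 'k) \<Rightarrow> ('h \<Rightarrow> 'k) \<Rightarrow> bool" where
  "polar_decomposition H K B U \<longleftrightarrow> B \<in> adjointable H K \<and> partial_isometry H K U
    \<and> B = U \<circ> op_abs H K B
    \<and> orthogonally_complemented H (closure (range (adj H K B)))
    \<and> adj H K U \<circ> U = proj H (closure (range (adj H K B)))"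

end

theory Submission
  imports Defs
begin

text \<open>
  Write \<open>P = \<bar>T\<bar>\<close> and \<open>Q = \<bar>S\<^sup>*\<bar> = U\<^sub>S \<bar>S\<bar> U\<^sub>S\<^sup>*\<close>, so that \<open>T = U\<^sub>T P\<close>, \<open>S = Q U\<^sub>S\<close> and \<open>Y = P A Q\<close>. The
  initial projection of \<open>U\<^sub>T\<close> fixes the range of \<open>P\<close> and the final projection of \<open>U\<^sub>S\<close> fixes the
  range of \<open>Q\<close>, whence \<open>X = U\<^sub>T Y U\<^sub>S\<close> and \<open>Y = U\<^sub>T\<^sup>* X U\<^sub>S\<^sup>*\<close>. This relation is symmetric under the
  exchange of \<open>X\<close> with \<open>Y\<close> and of the partial isometries with their adjoints, so (i) and (ii) are
  two instances of one fact, \<open>transfer\<close>. Its reason: \<open>U\<^sub>X\<close> absorbs the projections \<open>U\<^sub>T U\<^sub>T\<^sup>*\<close> on the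
  left and \<open>U\<^sub>S\<^sup>* U\<^sub>S\<close> on the right, because \<open>X\<close> does and \<open>U\<^sub>X\<close> is determined by \<open>X\<close> on the closure
  of \<open>\<R>(X\<^sup>*)\<close> and zero on the complement; so conjugation by \<open>U\<^sub>S\<close> carries \<open>\<bar>X\<bar>\<close> to \<open>\<bar>Y\<bar>\<close> and
  \<open>U\<^sub>X\<^sup>* U\<^sub>X\<close> to the projection onto the closure of \<open>\<R>(Y\<^sup>*)\<close>.

  To recognise \<open>\<bar>Y\<bar>\<close> as \<open>U\<^sub>S \<bar>X\<bar> U\<^sub>S\<^sup>*\<close> one needs that \<open>B\<^sup>* B\<close> has exactly one square root that is
  self-adjoint with spectrum in \<open>[0, \<infinity>)\<close>. Most of the text proves this from the axioms of \<open>C\<^sup>*\<close>-algebras and Hilbert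
  modules (\<open>op_abs_properties\<close>, \<open>op_abs_eqI\<close>). The argument runs through operators on modules
  whose inner product satisfies the Cauchy-Schwarz inequality but need not be known to be positive.
  A \<open>C\<^sup>*\<close>-algebra, seen as a module over itself, is one of these, and its elements act by left
  multiplication; hence facts about operators yield facts about the algebra, from these follows
  the Cauchy-Schwarz inequality in a Hilbert module, and then the same facts apply to the
  operators on the Hilbert module.

  Square roots do the work of the functional calculus. Call a self-adjoint \<open>C\<close> nonnegative if
  \<open>\<parallel>t - C\<parallel> \<le> t\<close> for some \<open>t \<ge> 0\<close>: such operators form a cone, and an iteration gives
  them square roots in their bicommutant. That nonnegativity means spectrum in \<open>[0, \<infinity>)\<close> rests on
  \<open>norm_reduction\<close>, which says that \<open>\<parallel>h\<parallel>\<^sup>2\<close> is in the spectrum of \<open>h\<^sup>2\<close> for self-adjoint \<open>h \<noteq> 0\<close> and is proved with square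
  roots alone, without the spectral radius formula. That \<open>B\<^sup>* B\<close> is nonnegative is
  \<open>nonneg_adjoint_comp\<close>.
\<close>

section \<open>Complex scalars, the involution, and inner products\<close>

lemma scaleC_eq_scaleR: "complex_of_real r *\<^sub>C x = r *\<^sub>R (x::'b::complex_banach)"
  by (simp add: scaleR_scaleC)

lemma bounded_linear_scaleC: "bounded_linear (\<lambda>x::'b::complex_banach. c *\<^sub>C x)"
proof (rule bounded_linear_intro[where K = "cmod c"])
  fix r :: real and x :: 'b
  show "c *\<^sub>C r *\<^sub>R x = r *\<^sub>R c *\<^sub>C x"
    by (simp add: scaleR_scaleC scaleC_scaleC mult.commute)
qed (auto simp: scaleC_add_right norm_scaleC mult.commute)

lemma norm_star: "norm (star a) = norm (a::'a::cstar_algebra)"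
proof -
  have le: "norm b \<le> norm (star b)" for b :: 'a
  proof (cases "b = 0")
    case False
    have "norm b * norm b \<le> norm (star b) * norm b"
      using cstar_identity[of b] norm_mult_ineq[of "star b" b] by (simp add: power2_eq_square)
    then show ?thesis using False by simp
  qed simp
  show ?thesis using le[of a] le[of "star a"] by (simp add: star_star)
qed

lemma norm_mult_star: "norm (a * star a) = (norm (a::'a::cstar_algebra))\<^sup>2"
  using cstar_identity[of "star a"] by (simp add: star_star norm_star)

text \<open>
  Positivity of the inner product is left out: for a \<open>C\<^sup>*\<close>-algebra as a module over itself it says
  that \<open>a\<^sup>* a\<close> is positive, which has to be proved, with operators on this very module.
\<close>

locale inner_product_module =
  fixes H :: "('h::complex_banach, 'a::cstar_algebra) hmodule"
  assumes ip_add_right: "ip H x (y + z) = ip H x y + ip H x z"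
    and ip_scaleC_right: "ip H x (c *\<^sub>C y) = c *\<^sub>C ip H x y"
    and ip_act_right: "ip H x (act H y a) = ip H x y * a"
    and ip_star: "star (ip H x y) = ip H y x"
    and ip_definite: "ip H x x = 0 \<Longrightarrow> x = 0"
    and norm_ip: "norm x = sqrt (norm (ip H x x))"
begin

lemma ip_add_left: "ip H (x + y) z = ip H x z + ip H y z"
  by (metis ip_add_right ip_star star_add)

lemma ip_scaleC_left: "ip H (c *\<^sub>C x) y = cnj c *\<^sub>C ip H x y"
  by (metis ip_scaleC_right ip_star star_scaleC)

lemma ip_scaleR_right: "ip H x (r *\<^sub>R y) = r *\<^sub>R ip H x y"
  by (simp add: scaleR_scaleC ip_scaleC_right)

lemma ip_scaleR_left: "ip H (r *\<^sub>R x) y = r *\<^sub>R ip H x y"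
  by (simp add: scaleR_scaleC ip_scaleC_left)

lemma ip_diff_right: "ip H x (y - z) = ip H x y - ip H x z"
  by (metis ip_add_right add_diff_cancel diff_add_cancel)

lemma ip_diff_left: "ip H (x - y) z = ip H x z - ip H y z"
  by (metis ip_add_left add_diff_cancel diff_add_cancel)

lemma ip_act_left: "ip H (act H x a) y = star a * ip H x y"
  by (metis ip_act_right ip_star star_mult)

lemma norm_ip_self: "norm (ip H x x) = (norm x)\<^sup>2"
  by (simp add: norm_ip)

lemma ip_right_eqI: "(\<And>x. ip H x y = ip H x z) \<Longrightarrow> y = z"
  using ip_definite[of "y - z"] by (simp add: ip_diff_right)

end

lemma is_adjoint_unique:
  assumes "inner_product_module H" "is_adjoint H K T T'" "is_adjoint H K T T''"
  shows "T' = T''"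
proof
  fix y
  interpret inner_product_module H by fact
  show "T' y = T'' y"
    by (rule ip_right_eqI) (metis assms(2,3) is_adjoint_def)
qed

lemma adj_eq:
  assumes "inner_product_module H" "is_adjoint H K T T'"
  shows "adj H K T = T'"
  unfolding adj_def using assms is_adjoint_unique by (metis the_equality)

lemma is_adjoint_sym:
  assumes "inner_product_module H" "inner_product_module K" "is_adjoint H K T T'"
  shows "is_adjoint K H T' T"
  using assms unfolding is_adjoint_def by (metis inner_product_module.ip_star)

lemma is_adjoint_adj:
  assumes "inner_product_module H" "T \<in> adjointable H K"
  shows "is_adjoint H K T (adj H K T)"
  using assms adj_eq unfolding adjointable_def by blast

lemma adjointableI: "is_adjoint H K T T' \<Longrightarrow> T \<in> adjointable H K"
  unfolding adjointable_def by blast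

lemma is_adjoint_comp:
  "is_adjoint K L S S' \<Longrightarrow> is_adjoint H K T T' \<Longrightarrow> is_adjoint H L (\<lambda>x. S (T x)) (\<lambda>x. T' (S' x))"
  by (simp add: is_adjoint_def)

lemma is_adjoint_add:
  assumes "inner_product_module H" "inner_product_module K" "is_adjoint H K S S'" "is_adjoint H K T T'"
  shows "is_adjoint H K (\<lambda>x. S x + T x) (\<lambda>x. S' x + T' x)"
  using assms unfolding is_adjoint_def
  by (simp add: inner_product_module.ip_add_left inner_product_module.ip_add_right)

lemma is_adjoint_diff:
  assumes "inner_product_module H" "inner_product_module K" "is_adjoint H K S S'" "is_adjoint H K T T'"
  shows "is_adjoint H K (\<lambda>x. S x - T x) (\<lambda>x. S' x - T' x)"
  using assms unfolding is_adjoint_def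
  by (simp add: inner_product_module.ip_diff_left inner_product_module.ip_diff_right)

lemma is_adjoint_scaleC:
  assumes "inner_product_module H" "inner_product_module K" "is_adjoint H K T T'"
  shows "is_adjoint H K (\<lambda>x. c *\<^sub>C T x) (\<lambda>x. cnj c *\<^sub>C T' x)"
  using assms unfolding is_adjoint_def
  by (simp add: inner_product_module.ip_scaleC_left inner_product_module.ip_scaleC_right)

lemma is_adjoint_scaleR:
  assumes "inner_product_module H" "inner_product_module K" "is_adjoint H K T T'"
  shows "is_adjoint H K (\<lambda>x. r *\<^sub>R T x) (\<lambda>x. r *\<^sub>R T' x)"
  using is_adjoint_scaleC[OF assms, of "complex_of_real r"] by (simp add: scaleC_eq_scaleR)

lemma is_adjoint_ident: "is_adjoint H H (\<lambda>x. x) (\<lambda>x. x)"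
  by (simp add: is_adjoint_def)

lemma is_adjoint_additive:
  assumes "inner_product_module H" "inner_product_module K" "is_adjoint H K T T'"
  shows "T (x + y) = T x + T y"
proof -
  interpret K: inner_product_module K by fact
  interpret H: inner_product_module H by fact
  have *: "ip K z (T v) = ip H (T' z) v" for z v
    using is_adjoint_sym[OF assms] by (simp add: is_adjoint_def)
  show ?thesis by (rule K.ip_right_eqI) (simp add: * K.ip_add_right H.ip_add_right)
qed

lemma is_adjoint_scaleC_commute:
  assumes "inner_product_module H" "inner_product_module K" "is_adjoint H K T T'"
  shows "T (c *\<^sub>C x) = c *\<^sub>C T x"
proof -
  interpret K: inner_product_module K by fact
  interpret H: inner_product_module H by fact
  have *: "ip K z (T v) = ip H (T' z) v" for z v
    using is_adjoint_sym[OF assms] by (simp add: is_adjoint_def)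
  show ?thesis by (rule K.ip_right_eqI) (simp add: * K.ip_scaleC_right H.ip_scaleC_right)
qed

lemma is_adjoint_act:
  assumes "inner_product_module H" "inner_product_module K" "is_adjoint H K T T'"
  shows "T (act H x a) = act K (T x) a"
proof -
  interpret K: inner_product_module K by fact
  interpret H: inner_product_module H by fact
  have *: "ip K z (T v) = ip H (T' z) v" for z v
    using is_adjoint_sym[OF assms] by (simp add: is_adjoint_def)
  show ?thesis by (rule K.ip_right_eqI) (simp add: * K.ip_act_right H.ip_act_right)
qed

section \<open>Boundedness of adjointable operators\<close>

text \<open>
  For a Hilbert module the Cauchy-Schwarz inequality is a consequence of positivity, but its proof
  uses order properties of the algebra. They are obtained from the theory below, applied to the
  algebra as a module over itself, where the inequality is just submultiplicativity of the norm.
\<close>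

locale cauchy_schwarz_module = inner_product_module H
  for H :: "('h::complex_banach, 'a::cstar_algebra) hmodule" +
  assumes cauchy_schwarz: "norm (ip H x y) \<le> norm x * norm y"
begin

lemma bounded_bilinear_ip: "bounded_bilinear (ip H)"
proof
  show "\<exists>k. \<forall>a b. norm (ip H a b) \<le> norm a * norm b * k"
    using cauchy_schwarz by (intro exI[of _ 1]) simp
qed (simp_all add: ip_add_left ip_add_right ip_scaleR_left ip_scaleR_right)


end

text \<open>
  \<open>\<parallel>T x\<parallel>\<close> is the supremum of \<open>\<parallel>\<langle>x, T\<^sup>* y\<rangle>\<parallel>\<close> over \<open>y\<close> in the unit ball, hence a finite supremum of
  continuous functions of \<open>x\<close>, and by the Baire category theorem it is bounded on some ball.
\<close>

lemma is_adjoint_bounded_linear: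
  fixes H :: "('h::complex_banach, 'a::cstar_algebra) hmodule"
    and K :: "('k::complex_banach, 'a) hmodule"
  assumes "cauchy_schwarz_module H" "cauchy_schwarz_module K" and adj: "is_adjoint H K T T'"
  shows "bounded_linear T"
proof -
  interpret H: cauchy_schwarz_module H by fact
  interpret K: cauchy_schwarz_module K by fact
  note ipm = H.inner_product_module_axioms K.inner_product_module_axioms
  have add: "T (x + y) = T x + T y" for x y
    by (rule is_adjoint_additive[OF ipm adj])
  have scale: "T (r *\<^sub>R x) = r *\<^sub>R T x" for r x
    unfolding scaleR_scaleC by (rule is_adjoint_scaleC_commute[OF ipm adj])
  define E where "E n = {x. \<forall>y. norm y \<le> 1 \<longrightarrow> norm (ip H x (T' y)) \<le> real n}" for n :: nat
  have closed: "closed (E n)" for n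
  proof -
    have "E n = (\<Inter>y\<in>{y. norm y \<le> 1}. {x. norm (ip H x (T' y)) \<le> real n})"
      by (auto simp: E_def)
    moreover have "continuous_on UNIV (\<lambda>x. norm (ip H x (T' y)))" for y
      by (intro continuous_on_norm
          bounded_linear.continuous_on[OF bounded_bilinear.bounded_linear_left[OF H.bounded_bilinear_ip]]
          continuous_on_id)
    ultimately show ?thesis
      by (auto intro!: closed_INT closed_Collect_le continuous_on_const)
  qed
  have cover: "(\<Union>n. E n) = UNIV"
  proof -
    have "x \<in> E (nat \<lceil>norm (T x)\<rceil>)" for x
    proof -
      have "norm (ip H x (T' y)) \<le> real (nat \<lceil>norm (T x)\<rceil>)" if "norm y \<le> 1" for y
      proof -
        have "norm (ip H x (T' y)) \<le> norm (T x) * norm y"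
          using adj K.cauchy_schwarz[of "T x" y] by (simp add: is_adjoint_def)
        also have "\<dots> \<le> norm (T x)" using that by (simp add: mult_left_le)
        finally show ?thesis by linarith
      qed
      then show ?thesis by (simp add: E_def)
    qed
    then show ?thesis by blast
  qed
  have "\<exists>n. interior (E n) \<noteq> {}"
  proof (rule ccontr)
    assume "\<not> ?thesis"
    then have "closedin euclidean S \<and> euclidean interior_of S = {}" if "S \<in> range E" for S
      using that closed by auto
    moreover have "Met_TC.mcomplete TYPE('h)"
      by (simp add: complete_UNIV)
    ultimately have "euclidean interior_of \<Union>(range E) = ({}::'h set)"
      using Met_TC.metric_Baire_category_alt[of "range E"] by auto
    then show False using cover by simp
  qed
  then obtain n x0 r where r: "r > 0" and sub: "ball x0 r \<subseteq> E n"
    by (meson ex_in_conv mem_interior)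
  have small: "norm (T z) \<le> 2 * real n" if "norm z < r" for z
  proof (cases "T z = 0")
    case False
    define y where "y = inverse (norm (T z)) *\<^sub>R T z"
    have y: "norm y \<le> 1" using False by (simp add: y_def)
    have "x0 + z \<in> E n" "x0 \<in> E n"
      using sub r that by (auto simp: dist_norm subset_eq)
    then have "norm (ip H (x0 + z) (T' y)) \<le> n" "norm (ip H x0 (T' y)) \<le> n"
      using y by (auto simp: E_def)
    moreover have "ip H z (T' y) = ip H (x0 + z) (T' y) - ip H x0 (T' y)"
      by (simp add: H.ip_add_left)
    ultimately have "norm (ip H z (T' y)) \<le> 2 * real n"
      using norm_triangle_ineq4[of "ip H (x0 + z) (T' y)" "ip H x0 (T' y)"] by simp
    moreover have "ip H z (T' y) = inverse (norm (T z)) *\<^sub>R ip K (T z) (T z)"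
      using adj K.ip_scaleR_right by (metis is_adjoint_def y_def)
    then have "norm (ip H z (T' y)) = norm (T z)"
      using False by (simp add: K.norm_ip_self power2_eq_square)
    ultimately show ?thesis by simp
  qed simp
  show ?thesis
  proof (rule bounded_linear_intro[where K = "4 * real n / r"])
    fix x
    show "norm (T x) \<le> norm x * (4 * real n / r)"
    proof (cases "x = 0")
      case True
      then show ?thesis using scale[of 0 x] by simp
    next
      case False
      define c where "c = r / (2 * norm x)"
      have c: "c > 0" using r False by (simp add: c_def)
      have "norm (c *\<^sub>R x) < r" using r False by (simp add: c_def)
      then have "norm (T (c *\<^sub>R x)) \<le> 2 * real n" by (rule small)
      then have "norm (T x) \<le> 2 * real n / c" using c by (simp add: scale field_simps)
      also have "\<dots> = norm x * (4 * real n / r)" using r False by (simp add: c_def field_simps)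
      finally show ?thesis .
    qed
  qed (simp_all add: add scale)
qed

lemma is_adjoint_norm_sq_le:
  assumes "cauchy_schwarz_module H" "inner_product_module K" and adj: "is_adjoint H K T T'"
  shows "(norm (T x))\<^sup>2 \<le> norm x * norm (T' (T x))"
  using adj cauchy_schwarz_module.cauchy_schwarz[OF assms(1), of x "T' (T x)"]
    inner_product_module.norm_ip_self[OF assms(2), of "T x"]
  by (simp add: is_adjoint_def)

context cauchy_schwarz_module
begin

abbreviation selfadj :: "('h \<Rightarrow> 'h) \<Rightarrow> bool" where
  "selfadj C \<equiv> is_adjoint H H C C"

lemma selfadj_bounded_linear: "selfadj C \<Longrightarrow> bounded_linear C"
  by (rule is_adjoint_bounded_linear) unfold_locales

lemmas selfadj_add = is_adjoint_add[OF inner_product_module_axioms inner_product_module_axioms, of C C D D for C D]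
lemmas selfadj_diff = is_adjoint_diff[OF inner_product_module_axioms inner_product_module_axioms, of C C D D for C D]
lemmas selfadj_scaleR = is_adjoint_scaleR[OF inner_product_module_axioms inner_product_module_axioms, of C C for C]
lemmas selfadj_ident = is_adjoint_ident[of H]

lemma selfadj_comp:
  assumes "selfadj C" "selfadj D" "\<And>x. C (D x) = D (C x)"
  shows "selfadj (\<lambda>x. C (D x))"
  using assms unfolding is_adjoint_def by metis

lemma selfadj_comp_self: "selfadj C \<Longrightarrow> selfadj (\<lambda>x. C (C x))"
  by (rule selfadj_comp[of C C]) auto

lemma selfadj_norm_sq_le: "selfadj C \<Longrightarrow> (norm (C x))\<^sup>2 \<le> norm x * norm (C (C x))"
  by (rule is_adjoint_norm_sq_le) unfold_locales

section \<open>Square roots\<close>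

definition commutant :: "('h \<Rightarrow> 'h) \<Rightarrow> ('h \<Rightarrow> 'h) set" where
  "commutant C = {D. bounded_linear D \<and> (\<forall>x. D (C x) = C (D x))}"

lemma commutantI: "selfadj D \<Longrightarrow> (\<And>x. D (C x) = C (D x)) \<Longrightarrow> D \<in> commutant C"
  by (simp add: commutant_def selfadj_bounded_linear)

lemma commutantD: "D \<in> commutant C \<Longrightarrow> D (C x) = C (D x)"
  by (simp add: commutant_def)

text \<open>
  The solution of \<open>w = (Z + w\<^sup>2) / 2\<close> is \<open>w = 1 - (1 - Z)\<^sup>1\<^sup>/\<^sup>2\<close>; this is the fixed point iteration
  for it, started at \<open>0\<close>. The same iteration for the number \<open>Z = 1\<close> dominates it in norm.
\<close>

primrec sqrt_iter :: "('h \<Rightarrow> 'h) \<Rightarrow> nat \<Rightarrow> 'h \<Rightarrow> 'h" where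
  "sqrt_iter Z 0 = (\<lambda>x. 0)"
| "sqrt_iter Z (Suc n) = (\<lambda>x. (1/2) *\<^sub>R (Z x + sqrt_iter Z n (sqrt_iter Z n x)))"

primrec sqrt_majorant :: "nat \<Rightarrow> real" where
  "sqrt_majorant 0 = 0"
| "sqrt_majorant (Suc n) = (1 + (sqrt_majorant n)\<^sup>2) / 2"

lemma sqrt_majorant_bounds: "0 \<le> sqrt_majorant n \<and> sqrt_majorant n \<le> 1"
proof (induction n)
  case (Suc n)
  then have "(sqrt_majorant n)\<^sup>2 \<le> 1" by (simp add: power_le_one)
  then show ?case by simp
qed simp

lemma sqrt_majorant_mono: "sqrt_majorant n \<le> sqrt_majorant (Suc n)"
  using zero_le_power2[of "1 - sqrt_majorant n"] by (simp add: power2_diff)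

lemma sqrt_iter_commute:
  assumes "linear D" "\<And>x. D (Z x) = Z (D x)"
  shows "D (sqrt_iter Z n x) = sqrt_iter Z n (D x)"
  by (induction n arbitrary: x) (simp_all add: linear_0 linear_scale linear_add assms)

lemma sqrt_iter_selfadj:
  assumes "selfadj Z" shows "selfadj (sqrt_iter Z n)"
proof (induction n)
  case 0
  show ?case using selfadj_scaleR[OF selfadj_ident, of 0] by simp
next
  case (Suc n)
  show ?case
    unfolding sqrt_iter.simps
    by (rule selfadj_scaleR, rule selfadj_add, rule assms, rule selfadj_comp_self, rule Suc)
qed

lemma sqrt_iter_norm_le:
  assumes "\<And>x. norm (Z x) \<le> norm x"
  shows "norm (sqrt_iter Z n x) \<le> sqrt_majorant n * norm x"
proof (induction n arbitrary: x)
  case (Suc n)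
  have "norm (sqrt_iter Z n (sqrt_iter Z n x)) \<le> sqrt_majorant n * norm (sqrt_iter Z n x)"
    by (rule Suc)
  also have "\<dots> \<le> sqrt_majorant n * (sqrt_majorant n * norm x)"
    using sqrt_majorant_bounds by (intro mult_left_mono Suc) auto
  finally have "norm (Z x + sqrt_iter Z n (sqrt_iter Z n x)) \<le> norm x + (sqrt_majorant n)\<^sup>2 * norm x"
    using norm_triangle_ineq[of "Z x" "sqrt_iter Z n (sqrt_iter Z n x)"] assms[of x]
    by (simp add: power2_eq_square mult.assoc)
  then show ?case by (simp add: distrib_right del: scaleR_right_distrib)
qed simp

text \<open>
  The iterates commute, so that \<open>v\<^sup>2 - u\<^sup>2 = (v + u) (v - u)\<close> for consecutive ones. The majorant
  satisfies the same recursion with equality, hence increments are dominated by increments. As the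
  majorant converges even for \<open>\<parallel>Z\<parallel> = 1\<close>, so do the iterates.
\<close>

lemma sqrt_iter_diff_le:
  assumes Z: "selfadj Z" and le: "\<And>x. norm (Z x) \<le> norm x"
  shows "norm (sqrt_iter Z (Suc n) x - sqrt_iter Z n x)
    \<le> (sqrt_majorant (Suc n) - sqrt_majorant n) * norm x"
proof (induction n arbitrary: x)
  case 0
  show ?case using le[of x] by simp
next
  case (Suc n)
  define u where "u = sqrt_iter Z n"
  define v where "v = sqrt_iter Z (Suc n)"
  define a where "a = sqrt_majorant n"
  define b where "b = sqrt_majorant (Suc n)"
  define y where "y = v x - u x"
  have lin: "linear (sqrt_iter Z m)" for m
    using selfadj_bounded_linear[OF sqrt_iter_selfadj[OF Z]] bounded_linear.linear by blast
  have "sqrt_iter Z m (Z x) = Z (sqrt_iter Z m x)" for m x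
    using sqrt_iter_commute[OF bounded_linear.linear[OF selfadj_bounded_linear[OF Z]], of Z] by simp
  then have comm: "v (u x) = u (v x)" for x
    unfolding u_def v_def by (rule sqrt_iter_commute[OF lin])
  have ab: "0 \<le> a" "0 \<le> b" "a \<le> b"
    using sqrt_majorant_bounds sqrt_majorant_mono by (auto simp: a_def b_def)
  have y: "norm y \<le> (b - a) * norm x"
    unfolding y_def u_def v_def a_def b_def by (rule Suc)
  have "norm (v y) \<le> b * norm y" "norm (u y) \<le> a * norm y"
    unfolding u_def v_def a_def b_def by (rule sqrt_iter_norm_le[OF le])+
  then have "norm (v y + u y) \<le> (b + a) * norm y"
    using norm_triangle_ineq[of "v y" "u y"] by (simp add: algebra_simps)
  also have "\<dots> \<le> (b + a) * ((b - a) * norm x)" using y ab by (intro mult_left_mono) auto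
  finally have "norm (v y + u y) \<le> (b\<^sup>2 - a\<^sup>2) * norm x"
    by (simp add: power2_eq_square algebra_simps)
  moreover have "sqrt_iter Z (Suc (Suc n)) x - sqrt_iter Z (Suc n) x = (1/2) *\<^sub>R (v (v x) - u (u x))"
  proof -
    have "sqrt_iter Z (Suc (Suc n)) x = (1/2) *\<^sub>R (Z x + v (v x))"
      "sqrt_iter Z (Suc n) x = (1/2) *\<^sub>R (Z x + u (u x))"
      by (simp_all add: u_def v_def)
    then show ?thesis by (simp add: algebra_simps)
  qed
  moreover have "v y + u y = v (v x) - u (u x)"
    using linear_diff[OF lin[of n]] linear_diff[OF lin[of "Suc n"]] comm[of x]
    by (simp add: y_def del: sqrt_iter.simps flip: u_def v_def)
  ultimately have "norm (sqrt_iter Z (Suc (Suc n)) x - sqrt_iter Z (Suc n) x) \<le> (b\<^sup>2 - a\<^sup>2) / 2 * norm x"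
    by simp
  also have "(b\<^sup>2 - a\<^sup>2) / 2 = sqrt_majorant (Suc (Suc n)) - sqrt_majorant (Suc n)"
    by (simp add: a_def b_def field_simps)
  finally show ?case .
qed

text \<open>
  The limit is taken pointwise. As the iterates are contractions, \<open>w\<^sub>n (w\<^sub>n x)\<close> still tends to
  \<open>w (w x)\<close>, so the limit solves the equation.
\<close>

lemma sqrt_one_minus:
  assumes Z: "selfadj Z" and le: "\<And>x. norm (Z x) \<le> norm x"
  obtains W where "selfadj W" "\<And>x. W (W x) = x - Z x" "\<And>x. norm (x - W x) \<le> norm x"
    "commutant Z \<subseteq> commutant W"
proof -
  let ?w = "sqrt_iter Z"
  have "incseq sqrt_majorant" by (rule incseq_SucI) (rule sqrt_majorant_mono)
  then obtain L where "sqrt_majorant \<longlonglongrightarrow> L"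
    using incseq_convergent[of sqrt_majorant 1] sqrt_majorant_bounds by blast
  then have "summable (\<lambda>n. sqrt_majorant (Suc n) - sqrt_majorant n)"
    by (rule telescope_summable)
  then have "summable (\<lambda>n. (sqrt_majorant (Suc n) - sqrt_majorant n) * norm x)" for x :: 'h
    by (rule summable_mult2)
  then have sm: "summable (\<lambda>n. ?w (Suc n) x - ?w n x)" for x
    by (rule summable_comparison_test') (rule sqrt_iter_diff_le[OF Z le])
  have "convergent (\<lambda>n. ?w n x)" for x
  proof -
    have "convergent (\<lambda>n. \<Sum>i<n. ?w (Suc i) x - ?w i x)"
      using sm by (simp only: summable_iff_convergent)
    then have "convergent (\<lambda>n. ?w n x - ?w 0 x)" by (simp only: sum_lessThan_telescope[of "\<lambda>n. ?w n x"])
    then show ?thesis by simp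
  qed
  then have "\<exists>l. (\<lambda>n. ?w n x) \<longlonglongrightarrow> l" for x by (simp add: convergent_def)
  then obtain w where lim: "\<And>x. (\<lambda>n. ?w n x) \<longlonglongrightarrow> w x" by metis
  have selfadj_w: "selfadj w"
    unfolding is_adjoint_def
  proof (intro allI)
    fix x y
    have "(\<lambda>n. ip H (?w n x) y) \<longlonglongrightarrow> ip H (w x) y"
      by (intro bounded_bilinear.tendsto[OF bounded_bilinear_ip] lim tendsto_const)
    moreover have "(\<lambda>n. ip H x (?w n y)) \<longlonglongrightarrow> ip H x (w y)"
      by (intro bounded_bilinear.tendsto[OF bounded_bilinear_ip] lim tendsto_const)
    moreover have "ip H (?w n x) y = ip H x (?w n y)" for n
      using sqrt_iter_selfadj[OF Z, of n] by (simp add: is_adjoint_def)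
    ultimately show "ip H (w x) y = ip H x (w y)" using LIMSEQ_unique by simp
  qed
  have iter_le: "norm (?w n x) \<le> norm x" for n x
    using sqrt_iter_norm_le[of Z n x, OF le] le sqrt_majorant_bounds[of n]
    by (smt (verit) mult_left_le_one_le norm_ge_zero)
  have w_le: "norm (w x) \<le> norm x" for x
    using tendsto_norm[OF lim[of x]] iter_le by (intro LIMSEQ_le_const2) auto
  have lim2: "(\<lambda>n. ?w n (?w n x)) \<longlonglongrightarrow> w (w x)" for x
  proof -
    have "(\<lambda>n. ?w n (?w n x - w x)) \<longlonglongrightarrow> 0"
    proof (rule Lim_null_comparison[where g = "\<lambda>n. norm (?w n x - w x)"])
      show "(\<lambda>n. norm (?w n x - w x)) \<longlonglongrightarrow> 0"
        using lim[of x] by (simp add: LIM_zero tendsto_norm_zero)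
    qed (simp add: iter_le)
    then have "(\<lambda>n. ?w n (?w n x - w x) + ?w n (w x)) \<longlonglongrightarrow> 0 + w (w x)"
      by (rule tendsto_add) (rule lim)
    moreover have "?w n (?w n x - w x) + ?w n (w x) = ?w n (?w n x)" for n
      using bounded_linear.linear[OF selfadj_bounded_linear[OF sqrt_iter_selfadj[OF Z, of n]]]
      by (simp add: linear_diff)
    ultimately show ?thesis by simp
  qed
  have fixpoint: "w x = (1/2) *\<^sub>R (Z x + w (w x))" for x
  proof (rule LIMSEQ_unique)
    show "(\<lambda>n. ?w (Suc n) x) \<longlonglongrightarrow> w x" by (rule LIMSEQ_Suc) (rule lim)
    show "(\<lambda>n. ?w (Suc n) x) \<longlonglongrightarrow> (1/2) *\<^sub>R (Z x + w (w x))"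
      unfolding sqrt_iter.simps by (intro tendsto_intros lim2)
  qed
  have two_w: "w x + w x = Z x + w (w x)" for x
    using arg_cong[OF fixpoint[of x], of "\<lambda>z. 2 *\<^sub>R z"] by (simp add: scaleR_2)
  have w_diff: "w (x - y) = w x - w y" for x y
    using bounded_linear.linear[OF selfadj_bounded_linear[OF selfadj_w]] by (simp add: linear_diff)
  show thesis
  proof
    show "selfadj (\<lambda>x. x - w x)" by (rule selfadj_diff[OF selfadj_ident selfadj_w])
    show "(x - w x) - w (x - w x) = x - Z x" for x
      using two_w[of x] by (simp add: w_diff algebra_simps)
    show "norm (x - (x - w x)) \<le> norm x" for x by (simp add: w_le)
    show "commutant Z \<subseteq> commutant (\<lambda>x. x - w x)"
    proof
      fix D assume "D \<in> commutant Z"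
      then have D: "bounded_linear D" and comm: "\<And>x. D (Z x) = Z (D x)"
        by (auto simp: commutant_def)
      have "D (w x) = w (D x)" for x
      proof -
        have "(\<lambda>n. D (?w n x)) \<longlonglongrightarrow> D (w x)" by (rule bounded_linear.tendsto[OF D lim])
        moreover have "D (?w n x) = ?w n (D x)" for n
          by (rule sqrt_iter_commute) (auto intro: bounded_linear.linear D comm)
        ultimately show ?thesis using lim[of "D x"] LIMSEQ_unique by simp
      qed
      then show "D \<in> commutant (\<lambda>x. x - w x)"
        using D bounded_linear.linear[OF D] by (simp add: commutant_def linear_diff)
    qed
  qed
qed

text \<open>
  In a \<open>C\<^sup>*\<close>-algebra this is one of the characterizations of positivity; unlike the spectral one it is
  visibly stable under sums.
\<close>

definition nonneg :: "('h \<Rightarrow> 'h) \<Rightarrow> bool" where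
  "nonneg C \<longleftrightarrow> selfadj C \<and> (\<exists>t\<ge>0. \<forall>x. norm (t *\<^sub>R x - C x) \<le> t * norm x)"

lemma nonneg_selfadj: "nonneg C \<Longrightarrow> selfadj C"
  by (simp add: nonneg_def)

lemma nonneg_add:
  assumes "nonneg C" "nonneg D" shows "nonneg (\<lambda>x. C x + D x)"
proof -
  obtain s t where s: "s \<ge> 0" "\<And>x. norm (s *\<^sub>R x - C x) \<le> s * norm x"
    and t: "t \<ge> 0" "\<And>x. norm (t *\<^sub>R x - D x) \<le> t * norm x"
    using assms by (auto simp: nonneg_def)
  have "norm ((s + t) *\<^sub>R x - (C x + D x)) \<le> (s + t) * norm x" for x
    using norm_triangle_ineq[of "s *\<^sub>R x - C x" "t *\<^sub>R x - D x"] s(2)[of x] t(2)[of x]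
    by (simp add: algebra_simps)
  then show ?thesis
    using s(1) t(1) assms by (auto simp: nonneg_def intro!: selfadj_add exI[of _ "s + t"])
qed

lemma nonneg_scaleR:
  assumes "nonneg C" "r \<ge> 0" shows "nonneg (\<lambda>x. r *\<^sub>R C x)"
proof -
  obtain s where s: "s \<ge> 0" "\<And>x. norm (s *\<^sub>R x - C x) \<le> s * norm x"
    using assms by (auto simp: nonneg_def)
  have "norm ((r * s) *\<^sub>R x - r *\<^sub>R C x) \<le> r * s * norm x" for x
  proof -
    have "(r * s) *\<^sub>R x - r *\<^sub>R C x = r *\<^sub>R (s *\<^sub>R x - C x)" by (simp add: algebra_simps)
    then show ?thesis using s(2)[of x] assms(2) by (simp add: mult.assoc mult_left_mono)
  qed
  then show ?thesis
    using s(1) assms by (auto simp: nonneg_def intro!: selfadj_scaleR exI[of _ "r * s"])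
qed

lemma nonneg_sqrt:
  assumes "nonneg C"
  obtains W where "nonneg W" "\<And>x. W (W x) = C x" "commutant C \<subseteq> commutant W"
proof -
  obtain t where t: "t \<ge> 0" "\<And>x. norm (t *\<^sub>R x - C x) \<le> t * norm x"
    using assms by (auto simp: nonneg_def)
  show thesis
  proof (cases "t = 0")
    case True
    then have C: "C x = 0" for x using t(2)[of x] by simp
    show thesis
    proof
      show "nonneg C" by fact
      show "C (C x) = C x" for x by (simp add: C)
    qed simp
  next
    case False
    define Z where "Z x = x - (1/t) *\<^sub>R C x" for x
    have Z: "selfadj Z"
      unfolding Z_def by (intro selfadj_diff selfadj_scaleR selfadj_ident nonneg_selfadj assms)
    have "norm (Z x) \<le> norm x" for x
    proof -
      have "Z x = (1/t) *\<^sub>R (t *\<^sub>R x - C x)" using False by (simp add: Z_def algebra_simps)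
      then have "norm (Z x) = norm (t *\<^sub>R x - C x) / t" using t(1) by simp
      also have "\<dots> \<le> norm x" using t False by (simp add: field_simps)
      finally show ?thesis .
    qed
    obtain W where W: "selfadj W" "\<And>x. W (W x) = x - Z x" "\<And>x. norm (x - W x) \<le> norm x"
      and comm: "commutant Z \<subseteq> commutant W"
      by (rule sqrt_one_minus[OF Z \<open>\<And>x. norm (Z x) \<le> norm x\<close>]) blast
    note lin = bounded_linear.linear[OF selfadj_bounded_linear[OF W(1)]]
    show thesis
    proof
      have "nonneg W" using W by (auto simp: nonneg_def intro: exI[of _ 1])
      then show "nonneg (\<lambda>x. sqrt t *\<^sub>R W x)" using t(1) by (simp add: nonneg_scaleR)
      show "sqrt t *\<^sub>R W (sqrt t *\<^sub>R W x) = C x" for x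
        using t(1) False by (simp add: linear_scale[OF lin] W(2) Z_def)
      show "commutant C \<subseteq> commutant (\<lambda>x. sqrt t *\<^sub>R W x)"
      proof
        fix D assume D: "D \<in> commutant C"
        then have lin: "linear D" by (simp add: commutant_def bounded_linear.linear)
        have "D \<in> commutant Z"
          using D by (simp add: commutant_def Z_def linear_diff[OF lin] linear_scale[OF lin])
        then have "D \<in> commutant W" using comm by blast
        then show "D \<in> commutant (\<lambda>x. sqrt t *\<^sub>R W x)"
          by (simp add: commutant_def linear_scale[OF lin])
      qed
    qed
  qed
qed



text \<open>
  Here \<open>z = h + \<i> w\<close> satisfies \<open>z\<^sup>* z = c = z z\<^sup>*\<close>, so \<open>\<parallel>z\<parallel>\<^sup>2 \<le> c\<close>, and \<open>h\<close> is the real part of \<open>z\<close>.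
  This is what can be said of the inequality \<open>h\<^sup>2 \<le> h\<^sup>2 + w\<^sup>2\<close> before any order is available.
\<close>

lemma norm_le_of_sum_squares:
  assumes h: "selfadj h" and w: "selfadj w" and comm: "\<And>x. h (w x) = w (h x)"
    and sq: "\<And>x. h (h x) + w (w x) = c *\<^sub>R x" and c: "c \<ge> 0"
  shows "norm (h x) \<le> sqrt c * norm x"
proof -
  note ipm = inner_product_module_axioms inner_product_module_axioms
  define z where "z x = h x + \<i> *\<^sub>C w x" for x
  define z' where "z' x = h x + cnj \<i> *\<^sub>C w x" for x
  have adj: "is_adjoint H H z z'"
    unfolding z_def z'_def by (intro is_adjoint_add[OF ipm] is_adjoint_scaleC[OF ipm] h w)
  note adj' = is_adjoint_sym[OF ipm adj]
  note lin = is_adjoint_additive[OF ipm h] is_adjoint_additive[OF ipm w]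
    is_adjoint_scaleC_commute[OF ipm h] is_adjoint_scaleC_commute[OF ipm w]
  have neg: "(-1) *\<^sub>C x = - x" for x :: 'h
    using scaleC_eq_scaleR[of "-1" x] by simp
  have ii: "\<i> *\<^sub>C y + (- \<i>) *\<^sub>C y = 0" for y :: 'h
    using scaleC_eq_scaleR[of 0 y] by (simp flip: scaleC_add_left)
  have one: "1 *\<^sub>C y = y" for y :: 'h by (rule scaleC_one)
  have zz: "z' (z x) = c *\<^sub>R x" "z (z' x) = c *\<^sub>R x" for x
  proof -
    have "z' (z x) = h (h x) + w (w x) + (\<i> *\<^sub>C w (h x) + (- \<i>) *\<^sub>C w (h x))"
      by (simp add: z_def z'_def lin scaleC_add_right scaleC_scaleC comm one)
    then show "z' (z x) = c *\<^sub>R x" by (simp add: ii sq)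
    have "z (z' x) = h (h x) + w (w x) + (\<i> *\<^sub>C w (h x) + (- \<i>) *\<^sub>C w (h x))"
      by (simp add: z_def z'_def lin scaleC_add_right scaleC_scaleC comm one)
    then show "z (z' x) = c *\<^sub>R x" by (simp add: ii sq)
  qed
  have bound: "norm y \<le> sqrt c * norm x" if "(norm y)\<^sup>2 \<le> norm x * norm (c *\<^sub>R x)" for x y :: 'h
  proof -
    have "norm x * norm (c *\<^sub>R x) = (sqrt c * norm x)\<^sup>2"
      using c by (simp add: power_mult_distrib) (simp add: power2_eq_square)
    then have "(norm y)\<^sup>2 \<le> (sqrt c * norm x)\<^sup>2" using that by simp
    then show ?thesis by (rule power2_le_imp_le) (simp add: c)
  qed
  have "norm (z x) \<le> sqrt c * norm x"
    by (rule bound)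
      (use is_adjoint_norm_sq_le[OF cauchy_schwarz_module_axioms inner_product_module_axioms adj, of x] in \<open>simp only: zz\<close>)
  moreover have "norm (z' x) \<le> sqrt c * norm x"
    by (rule bound)
      (use is_adjoint_norm_sq_le[OF cauchy_schwarz_module_axioms inner_product_module_axioms adj', of x] in \<open>simp only: zz\<close>)
  moreover have "z x + z' x = 2 *\<^sub>R h x"
  proof -
    have "z x + z' x = h x + h x + (\<i> *\<^sub>C w x + (- \<i>) *\<^sub>C w x)"
      by (simp add: z_def z'_def)
    then show ?thesis by (simp add: ii scaleR_2)
  qed
  ultimately show ?thesis
    using norm_triangle_ineq[of "z x" "z' x"] by simp
qed

lemma selfadj_sqrt_complement:
  assumes h: "selfadj h" and M: "M > 0" "\<And>x. norm (h x) \<le> M * norm x"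
  obtains W where "selfadj W" "\<And>x. W (W x) = M\<^sup>2 *\<^sub>R x - h (h x)"
    "commutant (\<lambda>x. h (h x)) \<subseteq> commutant W"
proof -
  have hh: "norm (h (h x)) \<le> M\<^sup>2 * norm x" for x
  proof -
    have "norm (h (h x)) \<le> M * norm (h x)" by (rule M(2))
    also have "\<dots> \<le> M * (M * norm x)" using M by (intro mult_left_mono) auto
    finally show ?thesis by (simp add: power2_eq_square mult.assoc)
  qed
  have "nonneg (\<lambda>x. M\<^sup>2 *\<^sub>R x - h (h x))"
    unfolding nonneg_def
    using selfadj_diff[OF selfadj_scaleR[OF selfadj_ident, of "M\<^sup>2"] selfadj_comp_self[OF h]] hh
    by (auto intro!: exI[of _ "M\<^sup>2"])
  then obtain W where W: "nonneg W" "\<And>x. W (W x) = M\<^sup>2 *\<^sub>R x - h (h x)"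
    and comm: "commutant (\<lambda>x. M\<^sup>2 *\<^sub>R x - h (h x)) \<subseteq> commutant W"
    by (rule nonneg_sqrt) blast
  show thesis
  proof
    show "selfadj W" using W(1) by (rule nonneg_selfadj)
    show "W (W x) = M\<^sup>2 *\<^sub>R x - h (h x)" for x by (rule W(2))
    have "commutant (\<lambda>x. h (h x)) \<subseteq> commutant (\<lambda>x. M\<^sup>2 *\<^sub>R x - h (h x))"
      by (auto simp: commutant_def linear_diff linear_scale bounded_linear.linear)
    then show "commutant (\<lambda>x. h (h x)) \<subseteq> commutant W" using comm by blast
  qed
qed

text \<open>
  If \<open>w\<close> is a root of \<open>M\<^sup>2 - h\<^sup>2\<close>, then \<open>h\<close> and \<open>w\<close> play symmetric roles in \<open>h\<^sup>2 + w\<^sup>2 = M\<^sup>2\<close>. So also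
  \<open>\<parallel>w\<parallel> \<le> M\<close>, that is, \<open>\<parallel>M\<^sup>2 - h\<^sup>2\<parallel> = \<parallel>w\<^sup>2\<parallel> \<le> M\<^sup>2\<close>.
\<close>

lemma nonneg_square:
  assumes h: "selfadj h" shows "nonneg (\<lambda>x. h (h x))"
proof -
  \<comment> \<open>The summand \<open>1\<close> makes the bound positive even for \<open>h = 0\<close>.\<close>
  define M where "M = onorm h + 1"
  note bl = selfadj_bounded_linear[OF h]
  have M: "M > 0" using onorm_pos_le[OF bl] by (simp add: M_def)
  have hM: "norm (h x) \<le> M * norm x" for x
    using onorm[OF bl, of x] by (simp add: M_def distrib_right add_increasing2)
  obtain W where W: "selfadj W" "\<And>x. W (W x) = M\<^sup>2 *\<^sub>R x - h (h x)"
    and comm: "commutant (\<lambda>x. h (h x)) \<subseteq> commutant W"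
    by (rule selfadj_sqrt_complement[OF h M hM]) blast
  have "h \<in> commutant W" using comm commutantI[OF h, of "\<lambda>x. h (h x)"] by blast
  have "norm (W x) \<le> sqrt (M\<^sup>2) * norm x" for x
    by (rule norm_le_of_sum_squares[OF W(1) h]) (simp_all add: W(2) commutantD[OF \<open>h \<in> commutant W\<close>])
  then have W_le: "norm (W x) \<le> M * norm x" for x using M by simp
  have "norm (M\<^sup>2 *\<^sub>R x - h (h x)) \<le> M\<^sup>2 * norm x" for x
  proof -
    have "norm (W (W x)) \<le> M * norm (W x)" by (rule W_le)
    also have "\<dots> \<le> M * (M * norm x)" using M W_le by (intro mult_left_mono) auto
    finally show ?thesis by (simp add: W(2) power2_eq_square mult.assoc)
  qed
  then show ?thesis
    using selfadj_comp_self[OF h] unfolding nonneg_def by (auto intro!: exI[of _ "M\<^sup>2"])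
qed


section \<open>Invertibility and the spectrum of self-adjoint operators\<close>

definition invertible_op :: "('h \<Rightarrow> 'h) \<Rightarrow> bool" where
  "invertible_op T \<longleftrightarrow> (\<exists>V \<in> adjointable H H. (\<forall>x. V (T x) = x) \<and> (\<forall>x. T (V x) = x))"

lemma op_spectrum_iff: "c \<in> op_spectrum H T \<longleftrightarrow> \<not> invertible_op (\<lambda>x. T x - c *\<^sub>C x)"
  by (simp add: op_spectrum_def invertible_op_def fun_eq_iff)

lemma adjointable_comp: "S \<in> adjointable H H \<Longrightarrow> T \<in> adjointable H H \<Longrightarrow> (\<lambda>x. S (T x)) \<in> adjointable H H"
  unfolding adjointable_def using is_adjoint_comp by blast

lemma invertible_op_comp:
  assumes "invertible_op S" "invertible_op T"
  shows "invertible_op (\<lambda>x. S (T x))"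
proof -
  obtain V W where "V \<in> adjointable H H" "\<And>x. V (S x) = x" "\<And>x. S (V x) = x"
    "W \<in> adjointable H H" "\<And>x. W (T x) = x" "\<And>x. T (W x) = x"
    using assms by (auto simp: invertible_op_def)
  then show ?thesis
    unfolding invertible_op_def by (intro bexI[of _ "\<lambda>x. W (V x)"]) (auto intro: adjointable_comp)
qed

lemma invertible_op_factor:
  assumes "invertible_op (\<lambda>x. S (T x))" and comm: "\<And>x. S (T x) = T (S x)"
    and T: "T \<in> adjointable H H"
  shows "invertible_op S"
proof -
  obtain V where V: "V \<in> adjointable H H" "\<And>x. V (S (T x)) = x" "\<And>x. S (T (V x)) = x"
    using assms(1) by (auto simp: invertible_op_def)
  have "T (V x) = V (T x)" for x
    by (metis V(2,3) comm)
  then show ?thesis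
    unfolding invertible_op_def using V T
    by (intro bexI[of _ "\<lambda>x. T (V x)"]) (auto intro: adjointable_comp simp: comm)
qed

lemma selfadj_bij_invertible_op:
  assumes "selfadj T" "bij T"
  shows "invertible_op T"
proof -
  have inv: "inv T (T x) = x" "T (inv T x) = x" for x
    using assms(2) by (simp_all add: bij_is_inj bij_is_surj surj_f_inv_f)
  have "selfadj (inv T)"
    unfolding is_adjoint_def
    by (metis assms(1) inv(2) is_adjoint_def)
  then show ?thesis
    unfolding invertible_op_def using inv by (intro bexI[of _ "inv T"]) (auto intro: adjointableI)
qed

lemma selfadj_inverse:
  assumes "selfadj T" "V \<in> adjointable H H" "\<And>x. V (T x) = x" "\<And>x. T (V x) = x"
  shows "selfadj V"
  unfolding is_adjoint_def by (metis assms(1,4) is_adjoint_def)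

lemma neumann_invertible:
  assumes Z: "selfadj Z" and le: "\<And>x. norm (Z x) \<le> q * norm x" and q: "0 \<le> q" "q < r"
  shows "invertible_op (\<lambda>x. r *\<^sub>R x - Z x)"
proof (rule selfadj_bij_invertible_op)
  show "selfadj (\<lambda>x. r *\<^sub>R x - Z x)"
    by (rule selfadj_diff[OF selfadj_scaleR[OF selfadj_ident] Z])
  note lin = bounded_linear.linear[OF selfadj_bounded_linear[OF Z]]
  have "\<exists>!x. r *\<^sub>R x - Z x = y" for y
  proof -
    define f where "f x = (1/r) *\<^sub>R (y + Z x)" for x
    have "dist (f u) (f v) \<le> q / r * dist u v" for u v
    proof -
      have "f u - f v = (1/r) *\<^sub>R Z (u - v)"
        by (simp add: f_def linear_diff[OF lin] algebra_simps)
      then show ?thesis using le[of "u - v"] q by (simp add: dist_norm field_simps)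
    qed
    then have "\<exists>!x. f x = x" using q by (intro banach_fix_type[of "q / r"]) auto
    moreover have "f x = x \<longleftrightarrow> r *\<^sub>R x - Z x = y" for x
    proof -
      have "f x = x \<longleftrightarrow> y + Z x = r *\<^sub>R x"
        using q by (auto simp: f_def vector_fraction_eq_iff scaleR_right_distrib[symmetric] real_vector_affinity_eq)
      then show ?thesis by (auto simp: algebra_simps)
    qed
    ultimately show ?thesis by simp
  qed
  then show "bij (\<lambda>x. r *\<^sub>R x - Z x)" by (simp add: bij_iff)
qed

lemma nonneg_shift_invertible:
  assumes "nonneg C" "\<epsilon> > 0"
  shows "invertible_op (\<lambda>x. C x + \<epsilon> *\<^sub>R x)"
proof -
  obtain t where t: "t \<ge> 0" "\<And>x. norm (t *\<^sub>R x - C x) \<le> t * norm x"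
    using assms by (auto simp: nonneg_def)
  have "invertible_op (\<lambda>x. (t + \<epsilon>) *\<^sub>R x - (t *\<^sub>R x - C x))"
    using t assms by (intro neumann_invertible[of _ t] selfadj_diff selfadj_scaleR selfadj_ident
        nonneg_selfadj) auto
  then show ?thesis by (simp add: algebra_simps)
qed

text \<open>
  This takes the place of the spectral radius formula: if \<open>M = \<parallel>h\<parallel> > 0\<close>, then \<open>M\<^sup>2 - h\<^sup>2\<close> cannot be
  invertible, so one of \<open>M\<close> and \<open>- M\<close> lies in the spectrum of \<open>h\<close>.

  Let \<open>V\<close> be the inverse of \<open>F = M\<^sup>2 - h\<^sup>2\<close> and \<open>m \<ge> \<parallel>V\<parallel>\<close>. Formally \<open>V \<le> m\<close>, so \<open>F \<ge> 1/m\<close> and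
  \<open>h\<^sup>2 \<le> M\<^sup>2 - 1/m\<close>. In place of the order, square roots witness this: with \<open>W\<^sup>2 = F\<close> and
  \<open>Y\<^sup>2 = 1 - V/m\<close>, commuting, \<open>(W Y)\<^sup>2 = F - 1/m\<close>, so \<open>h\<^sup>2 + (W Y)\<^sup>2 = M\<^sup>2 - 1/m\<close>.
\<close>

lemma norm_reduction:
  assumes h: "selfadj h" and M: "M > 0" "\<And>x. norm (h x) \<le> M * norm x"
    and inv: "invertible_op (\<lambda>x. M\<^sup>2 *\<^sub>R x - h (h x))"
  obtains \<rho> where "0 \<le> \<rho>" "\<rho> < M" "\<And>x. norm (h x) \<le> \<rho> * norm x"
proof -
  define F where "F x = M\<^sup>2 *\<^sub>R x - h (h x)" for x
  note blh = selfadj_bounded_linear[OF h]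
  note linh = bounded_linear.linear[OF blh]
  have F: "selfadj F"
    unfolding F_def by (intro selfadj_diff selfadj_scaleR selfadj_ident selfadj_comp_self[OF h])
  obtain W where W: "selfadj W" "\<And>x. W (W x) = F x"
    and commW: "commutant (\<lambda>x. h (h x)) \<subseteq> commutant W"
    unfolding F_def by (rule selfadj_sqrt_complement[OF h M]) blast
  have hW: "h (W x) = W (h x)" for x
    using commW commutantI[OF h, of "\<lambda>x. h (h x)"] commutantD by blast
  obtain V where "V \<in> adjointable H H" and VF: "\<And>x. V (F x) = x" and FV: "\<And>x. F (V x) = x"
    using inv by (auto simp: invertible_op_def F_def)
  then have V: "selfadj V" using selfadj_inverse[OF F] by blast
  have Vcomm: "V (D x) = D (V x)" if "\<And>x. F (D x) = D (F x)" for D x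
    by (metis FV VF that)
  have "F (h x) = h (F x)" for x
    by (simp add: F_def linear_diff[OF linh] linear_scale[OF linh])
  then have Vh: "V (h x) = h (V x)" for x by (rule Vcomm)
  have "F (W x) = W (F x)" for x by (simp flip: W(2))
  then have VW: "V (W x) = W (V x)" for x by (rule Vcomm)
  \<comment> \<open>The second summand guarantees \<open>M\<^sup>2 - 1/m \<ge> 0\<close>.\<close>
  define m where "m = onorm V + 1 / M\<^sup>2"
  have m: "m > 0" "1 / m \<le> M\<^sup>2"
  proof -
    have "m \<ge> 1 / M\<^sup>2" "1 / M\<^sup>2 > 0"
      using onorm_pos_le[OF selfadj_bounded_linear[OF V]] M(1) by (simp_all add: m_def)
    then show "m > 0" by linarith
    then show "1 / m \<le> M\<^sup>2" using \<open>m \<ge> 1 / M\<^sup>2\<close> M(1) by (simp add: field_simps)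
  qed
  define Z where "Z x = (1/m) *\<^sub>R V x" for x
  have Z: "selfadj Z" unfolding Z_def by (rule selfadj_scaleR[OF V])
  have "norm (Z x) \<le> norm x" for x
  proof -
    have "norm (V x) \<le> onorm V * norm x" by (rule onorm[OF selfadj_bounded_linear[OF V]])
    also have "\<dots> \<le> m * norm x" by (intro mult_right_mono) (simp_all add: m_def)
    finally show ?thesis using m by (simp add: Z_def field_simps)
  qed
  then obtain Y where Y: "selfadj Y" "\<And>x. Y (Y x) = x - Z x" and commY: "commutant Z \<subseteq> commutant Y"
    by (rule sqrt_one_minus[OF Z]) blast
  have "h \<in> commutant Z" "W \<in> commutant Z"
    using bounded_linear.linear[OF selfadj_bounded_linear[OF h]]
      bounded_linear.linear[OF selfadj_bounded_linear[OF W(1)]]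
    by (auto intro!: commutantI h W simp: Z_def Vh VW linear_scale)
  then have hY: "h (Y x) = Y (h x)" and WY: "W (Y x) = Y (W x)" for x
    using commY commutantD by blast+
  define X where "X x = W (Y x)" for x
  have X: "selfadj X" unfolding X_def by (rule selfadj_comp[OF W(1) Y(1) WY])
  note linF = bounded_linear.linear[OF selfadj_bounded_linear[OF F]]
  have XX: "X (X x) = F x - (1/m) *\<^sub>R x" for x
  proof -
    have "X (X x) = W (W (Y (Y x)))" by (simp add: X_def WY)
    also have "\<dots> = F (x - Z x)" by (simp add: W(2) Y(2))
    also have "\<dots> = F x - (1/m) *\<^sub>R x" by (simp add: Z_def linear_diff[OF linF] linear_scale[OF linF] FV)
    finally show ?thesis .
  qed
  have "norm (h x) \<le> sqrt (M\<^sup>2 - 1/m) * norm x" for x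
  proof (rule norm_le_of_sum_squares[OF h X])
    show "h (X x) = X (h x)" for x by (simp add: X_def hW hY)
    show "h (h x) + X (X x) = (M\<^sup>2 - 1/m) *\<^sub>R x" for x
      by (simp add: XX F_def scaleR_diff_left)
    show "0 \<le> M\<^sup>2 - 1/m" using m by simp
  qed
  moreover have "sqrt (M\<^sup>2 - 1/m) < M"
    using m M(1) by (intro real_less_lsqrt) auto
  ultimately show thesis using m by (intro that[of "sqrt (M\<^sup>2 - 1/m)"]) auto
qed

lemma not_invertible_at_norm:
  assumes h: "selfadj h" and "onorm h > 0"
  shows "\<not> invertible_op (\<lambda>x. (onorm h)\<^sup>2 *\<^sub>R x - h (h x))"
proof
  assume inv: "invertible_op (\<lambda>x. (onorm h)\<^sup>2 *\<^sub>R x - h (h x))"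
  note bl = selfadj_bounded_linear[OF h]
  obtain \<rho> where "0 \<le> \<rho>" "\<rho> < onorm h" "\<And>x. norm (h x) \<le> \<rho> * norm x"
    by (rule norm_reduction[OF h assms(2) onorm[OF bl] inv]) blast
  then show False using onorm_bound[of \<rho> h] by auto
qed

text \<open>
  For \<open>h = r - C\<close> and \<open>N = \<parallel>h\<parallel> > r\<close>, both factors of \<open>N\<^sup>2 - h\<^sup>2 = (C + (N - r)) ((N + r) - C)\<close> would be
  invertible: the first by assumption, the second because \<open>\<parallel>C\<parallel> \<le> r < N + r\<close>.
\<close>

lemma norm_complement_le:
  assumes C: "selfadj C" and inv: "\<And>\<epsilon>. \<epsilon> > 0 \<Longrightarrow> invertible_op (\<lambda>x. C x + \<epsilon> *\<^sub>R x)"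
    and r: "r \<ge> 0" "\<And>x. norm (C x) \<le> r * norm x"
  shows "norm (r *\<^sub>R x - C x) \<le> r * norm x"
proof -
  define h where "h x = r *\<^sub>R x - C x" for x
  have h: "selfadj h" unfolding h_def by (intro selfadj_diff selfadj_scaleR selfadj_ident C)
  note bl = selfadj_bounded_linear[OF h]
  note linC = bounded_linear.linear[OF selfadj_bounded_linear[OF C]]
  define N where "N = onorm h"
  have "N \<le> r"
  proof (rule ccontr)
    assume "\<not> N \<le> r"
    then have N: "N > r" "N > 0" using r by auto
    have "invertible_op (\<lambda>x. C x + (N - r) *\<^sub>R x)" using N by (intro inv) simp
    moreover have "invertible_op (\<lambda>x. (N + r) *\<^sub>R x - C x)"
      using N r by (intro neumann_invertible[OF C, of r]) auto
    ultimately have "invertible_op (\<lambda>x. C ((N + r) *\<^sub>R x - C x) + (N - r) *\<^sub>R ((N + r) *\<^sub>R x - C x))"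
      by (rule invertible_op_comp)
    moreover have "C ((N + r) *\<^sub>R x - C x) + (N - r) *\<^sub>R ((N + r) *\<^sub>R x - C x) = N\<^sup>2 *\<^sub>R x - h (h x)" for x
      by (simp add: h_def linear_diff[OF linC] linear_add[OF linC] linear_scale[OF linC] algebra_simps power2_eq_square)
    ultimately show False using not_invertible_at_norm[OF h] N by (simp add: N_def)
  qed
  then show ?thesis
    using onorm[OF bl, of x] mult_right_mono[of N r "norm x"] by (simp add: h_def N_def)
qed

lemma nonneg_norm_complement_le:
  assumes "nonneg C" "r \<ge> 0" "\<And>x. norm (C x) \<le> r * norm x"
  shows "norm (r *\<^sub>R x - C x) \<le> r * norm x"
  using assms by (intro norm_complement_le) (auto intro: nonneg_selfadj nonneg_shift_invertible)

lemma nonnegI_invertible: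
  assumes C: "selfadj C" and inv: "\<And>\<epsilon>. \<epsilon> > 0 \<Longrightarrow> invertible_op (\<lambda>x. C x + \<epsilon> *\<^sub>R x)"
  shows "nonneg C"
proof -
  note bl = selfadj_bounded_linear[OF C]
  have "norm (onorm C *\<^sub>R x - C x) \<le> onorm C * norm x" for x
    by (rule norm_complement_le[OF C inv onorm_pos_le[OF bl] onorm[OF bl]])
  then show ?thesis using C onorm_pos_le[OF bl] by (auto simp: nonneg_def)
qed

text \<open>
  Spectrum in \<open>[0, \<infinity>)\<close> makes \<open>C + \<epsilon>\<close> invertible, which is all that the norm estimate needs.
  Conversely, \<open>C - c\<close> is invertible for \<open>c < 0\<close> by the Neumann series, and for \<open>c = a + \<i> b\<close> with
  \<open>b \<noteq> 0\<close> it is a factor of \<open>(C - a)\<^sup>2 + b\<^sup>2\<close>, a nonnegative operator plus a positive number.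
\<close>

lemma op_positive_iff_nonneg: "op_positive H C \<longleftrightarrow> nonneg C"
proof
  assume *: "op_positive H C"
  then have "selfadj C" using is_adjoint_adj[OF inner_product_module_axioms] unfolding op_positive_def by metis
  then show "nonneg C"
  proof (rule nonnegI_invertible)
    fix \<epsilon> :: real assume "\<epsilon> > 0"
    then have "complex_of_real (- \<epsilon>) \<notin> op_spectrum H C"
      using * unfolding op_positive_def by (auto simp: subset_eq complex_nonneg_Reals_iff)
    then have "invertible_op (\<lambda>x. C x - complex_of_real (- \<epsilon>) *\<^sub>C x)"
      by (simp only: op_spectrum_iff not_not)
    then show "invertible_op (\<lambda>x. C x + \<epsilon> *\<^sub>R x)" unfolding scaleC_eq_scaleR by simp
  qed
next
  assume *: "nonneg C"
  then have C: "selfadj C" by (rule nonneg_selfadj)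
  note ipm = inner_product_module_axioms inner_product_module_axioms
  have "c \<notin> op_spectrum H C" if "c \<notin> \<real>\<^sub>\<ge>\<^sub>0" for c
  proof (cases "Im c = 0")
    case True
    then have "Re c < 0" "c = complex_of_real (Re c)"
      using that by (auto simp: complex_nonneg_Reals_iff complex_eq_iff)
    then have "invertible_op (\<lambda>x. C x + (- Re c) *\<^sub>R x)" by (intro nonneg_shift_invertible[OF *]) simp
    then have "invertible_op (\<lambda>x. C x - complex_of_real (Re c) *\<^sub>C x)" unfolding scaleC_eq_scaleR by simp
    then show ?thesis using \<open>c = complex_of_real (Re c)\<close> op_spectrum_iff by metis
  next
    case False
    define h where "h x = C x - Re c *\<^sub>R x" for x
    define z where "z x = h x + (- (\<i> * Im c)) *\<^sub>C x" for x
    define z' where "z' x = h x + (\<i> * Im c) *\<^sub>C x" for x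
    have h: "selfadj h" unfolding h_def by (intro selfadj_diff selfadj_scaleR selfadj_ident C)
    note lin = is_adjoint_additive[OF ipm h] is_adjoint_scaleC_commute[OF ipm h]
    have "is_adjoint H H z' (\<lambda>x. h x + cnj (\<i> * Im c) *\<^sub>C x)"
      unfolding z'_def by (intro is_adjoint_add[OF ipm] is_adjoint_scaleC[OF ipm] h selfadj_ident)
    then have z': "z' \<in> adjointable H H" by (rule adjointableI)
    have cancel: "a *\<^sub>C y + (- a) *\<^sub>C y = 0" for a and y :: 'h
      using scaleC_eq_scaleR[of 0 y] by (simp flip: scaleC_add_left)
    have sq: "z (z' x) = h (h x) + (Im c)\<^sup>2 *\<^sub>R x" for x
    proof -
      have "z (z' x) = h (h x) + ((\<i> * Im c) *\<^sub>C h x + (- (\<i> * Im c)) *\<^sub>C h x)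
          + (- (\<i> * Im c) * (\<i> * Im c)) *\<^sub>C x"
        by (simp add: z_def z'_def lin scaleC_add_right scaleC_scaleC)
      also have "- (\<i> * Im c) * (\<i> * Im c) = complex_of_real ((Im c)\<^sup>2)"
        by (simp add: power2_eq_square complex_eq_iff)
      finally show ?thesis by (simp add: cancel scaleC_eq_scaleR del: of_real_power)
    qed
    have comm: "z (z' x) = z' (z x)" for x
      by (simp add: z_def z'_def lin scaleC_add_right scaleC_scaleC)
    have "invertible_op (\<lambda>x. z (z' x))"
      unfolding sq using False by (intro nonneg_shift_invertible nonneg_square h) simp
    then have "invertible_op z" by (rule invertible_op_factor[of z z']) (auto simp: comm z')
    moreover have "z = (\<lambda>x. C x - c *\<^sub>C x)"
    proof
      fix x :: 'h
      have "c *\<^sub>C x = Re c *\<^sub>R x + (\<i> * Im c) *\<^sub>C x"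
        by (metis complex_eq scaleC_add_left scaleC_eq_scaleR)
      moreover have "(- (\<i> * Im c)) *\<^sub>C x = - ((\<i> * Im c) *\<^sub>C x)"
        using cancel[of "\<i> * Im c" x] by (simp add: add_eq_0_iff)
      ultimately show "z x = C x - c *\<^sub>C x" by (simp add: z_def h_def)
    qed
    ultimately show ?thesis by (simp add: op_spectrum_iff)
  qed
  moreover have "adj H H C = C" by (rule adj_eq[OF inner_product_module_axioms C])
  ultimately show "op_positive H C"
    using adjointableI[OF C] unfolding op_positive_def by blast
qed

text \<open>
  Monotonicity of the norm on the cone. If \<open>N = \<parallel>A\<parallel> > r \<ge> \<parallel>A + B\<parallel>\<close>, then \<open>r - A = (r - (A + B)) + B\<close>
  is nonnegative, so \<open>N - A\<close> and \<open>N + A\<close> are both invertible, and so is \<open>N\<^sup>2 - A\<^sup>2\<close>.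
\<close>

lemma nonneg_norm_mono:
  assumes A: "nonneg A" and B: "nonneg B" and r: "r \<ge> 0" "\<And>x. norm (A x + B x) \<le> r * norm x"
  shows "norm (A x) \<le> r * norm x"
proof -
  note bl = selfadj_bounded_linear[OF nonneg_selfadj[OF A]]
  note lin = bounded_linear.linear[OF bl]
  define N where "N = onorm A"
  have "N \<le> r"
  proof (rule ccontr)
    assume "\<not> N \<le> r"
    then have N: "N > r" "N > 0" using r by auto
    have "norm (r *\<^sub>R x - (A x + B x)) \<le> r * norm x" for x
      by (rule nonneg_norm_complement_le[OF nonneg_add[OF A B] r])
    then have "nonneg (\<lambda>x. r *\<^sub>R x - (A x + B x))"
      unfolding nonneg_def
      using r selfadj_diff[OF selfadj_scaleR[OF selfadj_ident, of r] nonneg_selfadj[OF nonneg_add[OF A B]]]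
      by (auto intro!: exI[of _ r] simp: add.commute)
    from nonneg_add[OF this B] have "nonneg (\<lambda>x. r *\<^sub>R x - A x)" by simp
    then have "invertible_op (\<lambda>x. (r *\<^sub>R x - A x) + (N - r) *\<^sub>R x)"
      using N by (intro nonneg_shift_invertible) auto
    then have "invertible_op (\<lambda>x. N *\<^sub>R x - A x)" by (simp add: algebra_simps)
    moreover have "invertible_op (\<lambda>x. A x + N *\<^sub>R x)"
      using N by (intro nonneg_shift_invertible A)
    ultimately have "invertible_op (\<lambda>x. N *\<^sub>R (A x + N *\<^sub>R x) - A (A x + N *\<^sub>R x))"
      by (rule invertible_op_comp)
    moreover have "N *\<^sub>R (A x + N *\<^sub>R x) - A (A x + N *\<^sub>R x) = N\<^sup>2 *\<^sub>R x - A (A x)" for x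
      by (simp add: linear_add[OF lin] linear_scale[OF lin] algebra_simps power2_eq_square)
    ultimately show False using not_invertible_at_norm[OF nonneg_selfadj[OF A]] N by (simp add: N_def)
  qed
  then show ?thesis
    using onorm[OF bl, of x] mult_right_mono[of N r "norm x"] by (simp add: N_def)
qed

end

section \<open>Positivity of \<open>B\<^sup>* B\<close>\<close>

context cauchy_schwarz_module
begin

text \<open>
  Let \<open>h = B\<^sup>* B\<close>, let \<open>p\<close> be the root of \<open>h\<^sup>2\<close>, in other words \<open>\<bar>h\<bar>\<close>, and \<open>k = p - h\<close>, twice the
  negative part of \<open>h\<close>. From \<open>h k = p h - p\<^sup>2 = - p k\<close> follows \<open>(B k)\<^sup>* (B k) = k h k = - k p k\<close>, the
  negative of a square since \<open>p\<close> is one. If only \<open>0\<close> can satisfy this, then \<open>B k = 0\<close>, so \<open>k\<^sup>2 = 0\<close>, and \<open>h = p\<close>.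

  The hypothesis on negative squares is left open, since it holds for different reasons in the two
  applications: for endomorphisms by comparing \<open>D\<^sup>* D\<close> with \<open>D D\<^sup>*\<close>, and between Hilbert modules by
  positivity of the inner products.
\<close>

lemma nonneg_adjoint_comp:
  assumes ipK: "inner_product_module K" and adj: "is_adjoint H K B B'"
    and no_negative: "\<And>D D' G x. is_adjoint H K D D' \<Longrightarrow> selfadj G \<Longrightarrow>
      (\<And>x. D' (D x) = - G (G x)) \<Longrightarrow> D x = 0"
  shows "nonneg (\<lambda>x. B' (B x))"
proof -
  define h where "h x = B' (B x)" for x
  have h: "selfadj h"
    unfolding h_def using is_adjoint_comp[OF is_adjoint_sym[OF inner_product_module_axioms ipK adj] adj] .
  obtain p where p: "nonneg p" "\<And>x. p (p x) = h (h x)"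
    and comm_p: "commutant (\<lambda>x. h (h x)) \<subseteq> commutant p"
    by (rule nonneg_sqrt[OF nonneg_square[OF h]]) blast
  obtain g where g: "nonneg g" "\<And>x. g (g x) = p x" and comm_g: "commutant p \<subseteq> commutant g"
    by (rule nonneg_sqrt[OF p(1)]) blast
  have "h \<in> commutant p" using comm_p commutantI[OF h, of "\<lambda>x. h (h x)"] by blast
  then have hp: "h (p x) = p (h x)" and hg: "h (g x) = g (h x)" for x
    using comm_g commutantD by blast+
  have gp: "g (p x) = p (g x)" for x by (simp flip: g(2))
  define k where "k x = p x - h x" for x
  have k: "selfadj k" unfolding k_def by (rule selfadj_diff[OF nonneg_selfadj[OF p(1)] h])
  have diff: "f (x - y) = f x - f y" if "selfadj f" for f x y
    using bounded_linear.linear[OF selfadj_bounded_linear[OF that]] by (simp add: linear_diff)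
  note diff_simps = diff[OF h] diff[OF nonneg_selfadj[OF p(1)]] diff[OF nonneg_selfadj[OF g(1)]]
  have gk: "g (k x) = k (g x)" for x by (simp add: k_def diff_simps gp hg)
  have hk: "h (k x) = - p (k x)" for x by (simp add: k_def diff_simps hp p(2))
  have kh: "k (h x) = h (k x)" and kp: "k (p x) = p (k x)" for x
    by (simp_all add: k_def diff_simps hp)
  define G where "G x = g (k x)" for x
  have G: "selfadj G" unfolding G_def by (rule selfadj_comp[OF nonneg_selfadj[OF g(1)] k gk])
  have adjBk: "is_adjoint H K (\<lambda>x. B (k x)) (\<lambda>x. k (B' x))" by (rule is_adjoint_comp[OF adj k])
  have "k (B' (B (k x))) = - G (G x)" for x
  proof -
    have "k (B' (B (k x))) = h (k (k x))" by (simp add: kh flip: h_def)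
    also have "\<dots> = - p (k (k x))" by (rule hk)
    also have "\<dots> = - g (k (g (k x)))" by (simp add: gk flip: g(2))
    finally show ?thesis by (simp add: G_def)
  qed
  then have Bk: "B (k x) = 0" for x by (rule no_negative[OF adjBk G])
  have B'0: "B' 0 = 0"
    using bounded_linear.linear[OF selfadj_bounded_linear[OF h]] is_adjoint_sym[OF inner_product_module_axioms ipK adj]
      is_adjoint_scaleC_commute[OF ipK inner_product_module_axioms, of B' B 0 0]
      scaleC_eq_scaleR[of 0 "B' 0"] scaleC_eq_scaleR[of 0 "0::'b"] by simp
  have "h (k x) = 0" for x by (simp add: h_def Bk B'0)
  moreover from this have "p (k x) = 0" for x using hk[of x] by simp
  ultimately have "k (k x) = 0" for x by (simp add: k_def[of "k x"])
  then have "k x = 0" for x using selfadj_norm_sq_le[OF k, of x] by simp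
  then have "p = h" by (auto simp: k_def fun_eq_iff)
  then show ?thesis using p(1) by (simp add: h_def[abs_def])
qed

text \<open>
  With \<open>u = D + D\<^sup>*\<close> and \<open>v = \<i> (D - D\<^sup>*)\<close> one has \<open>D D\<^sup>* = (u\<^sup>2 + v\<^sup>2) / 2 - D\<^sup>* D = (u\<^sup>2 + v\<^sup>2) / 2 + G\<^sup>2\<close>, which
  is nonnegative. The spectra of \<open>D D\<^sup>*\<close> and \<open>D\<^sup>* D = - G\<^sup>2\<close> agree away from \<open>0\<close>. So \<open>- G\<^sup>2 + s\<close> is invertible
  for every \<open>s > 0\<close>, and at \<open>s = \<parallel>G\<parallel>\<^sup>2\<close> this is impossible unless \<open>G = 0\<close>.
\<close>

lemma adjoint_comp_not_negative:
  assumes adj: "is_adjoint H H D D'" and G: "selfadj G" and neg: "\<And>x. D' (D x) = - G (G x)"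
  shows "D x = 0"
proof -
  note ipm = inner_product_module_axioms inner_product_module_axioms
  note adj' = is_adjoint_sym[OF ipm adj]
  note blG = selfadj_bounded_linear[OF G]
  have lin: "linear D" "linear D'" "linear G"
    using is_adjoint_bounded_linear[OF cauchy_schwarz_module_axioms cauchy_schwarz_module_axioms] adj adj' G
      bounded_linear.linear by blast+
  define u where "u x = D x + D' x" for x
  define v where "v x = \<i> *\<^sub>C (D x - D' x)" for x
  have u: "selfadj u"
    using is_adjoint_add[OF ipm adj adj'] by (simp add: u_def[abs_def] add.commute)
  have neg_scale: "(- c) *\<^sub>C (a - b) = c *\<^sub>C (b - a)" for c and a b :: 'h
  proof -
    have "(- c) *\<^sub>C (a - b) = c *\<^sub>C (complex_of_real (-1) *\<^sub>C (a - b))" by (simp add: scaleC_scaleC)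
    then show ?thesis unfolding scaleC_eq_scaleR by simp
  qed
  have v: "selfadj v"
    using is_adjoint_scaleC[OF ipm is_adjoint_diff[OF ipm adj adj'], of \<i>]
    by (simp add: v_def[abs_def] neg_scale)
  have vv: "v (v x) = - (D (D x - D' x) - D' (D x - D' x))" for x
  proof -
    have "v (v x) = \<i> *\<^sub>C \<i> *\<^sub>C (D (D x - D' x) - D' (D x - D' x))"
      unfolding v_def using is_adjoint_scaleC_commute[OF ipm is_adjoint_diff[OF ipm adj adj']] by simp
    also have "\<dots> = complex_of_real (-1) *\<^sub>C (D (D x - D' x) - D' (D x - D' x))"
      by (simp add: scaleC_scaleC)
    finally show ?thesis unfolding scaleC_eq_scaleR by simp
  qed
  have DD': "D (D' x) = (1/2) *\<^sub>R (u (u x) + v (v x)) + G (G x)" for x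
  proof -
    have "u (u x) + v (v x) = 2 *\<^sub>R D (D' x) + 2 *\<^sub>R D' (D x)"
      by (simp add: u_def vv linear_add[OF lin(1)] linear_add[OF lin(2)] linear_diff[OF lin(1)]
          linear_diff[OF lin(2)] scaleR_2)
    then show ?thesis by (simp add: neg scaleR_right_diff_distrib)
  qed
  have nonneg: "nonneg (\<lambda>x. D (D' x))"
    unfolding DD' by (intro nonneg_add nonneg_scaleR nonneg_square u v G) simp
  have inv: "invertible_op (\<lambda>x. D' (D x) + s *\<^sub>R x)" if s: "s > 0" for s
  proof (rule selfadj_bij_invertible_op)
    show "selfadj (\<lambda>x. D' (D x) + s *\<^sub>R x)"
      by (rule selfadj_add[OF is_adjoint_comp[OF adj' adj] selfadj_scaleR[OF selfadj_ident]])
    obtain V where V: "\<And>x. V (D (D' x) + s *\<^sub>R x) = x" "\<And>x. D (D' (V x)) + s *\<^sub>R V x = x"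
      using nonneg_shift_invertible[OF nonneg s] by (auto simp: invertible_op_def)
    \<comment> \<open>\<open>(D\<^sup>* D + s)\<^sup>-\<^sup>1 = (1 - D\<^sup>* (D D\<^sup>* + s)\<^sup>-\<^sup>1 D) / s\<close>.\<close>
    let ?W = "\<lambda>y. (1/s) *\<^sub>R (y - D' (V (D y)))"
    have left: "?W (D' (D x) + s *\<^sub>R x) = x" for x
    proof -
      have "V (D (D' (D x) + s *\<^sub>R x)) = D x"
        using V(1)[of "D x"] by (simp add: linear_add[OF lin(1)] linear_scale[OF lin(1)])
      then show ?thesis using s by simp
    qed
    have right: "D' (D (?W y)) + s *\<^sub>R ?W y = y" for y
    proof -
      let ?z = "V (D y)"
      have "D (D' ?z) = D y - s *\<^sub>R ?z" using V(2)[of "D y"] by (simp add: algebra_simps)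
      then have "D' (D (D' ?z)) = D' (D y) - s *\<^sub>R D' ?z"
        by (simp add: linear_diff[OF lin(2)] linear_scale[OF lin(2)])
      then show ?thesis using s
        by (simp add: linear_diff[OF lin(1)] linear_diff[OF lin(2)] linear_scale[OF lin(1)]
            linear_scale[OF lin(2)])
    qed
    show "bij (\<lambda>x. D' (D x) + s *\<^sub>R x)"
      by (rule o_bij[of ?W]) (use left right in \<open>auto simp: fun_eq_iff simp del: scaleR_diff_right\<close>)
  qed
  have "onorm G = 0"
  proof (rule ccontr)
    assume "onorm G \<noteq> 0"
    then have "onorm G > 0" using onorm_pos_le[OF blG] by simp
    moreover from this have "invertible_op (\<lambda>x. D' (D x) + (onorm G)\<^sup>2 *\<^sub>R x)" by (intro inv) simp
    ultimately show False using not_invertible_at_norm[OF G] by (simp add: neg)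
  qed
  then have "G y = 0" for y using onorm_eq_0[OF blG] by simp
  then have "D' (D x) = 0" by (simp add: neg)
  then show ?thesis
    using is_adjoint_norm_sq_le[OF cauchy_schwarz_module_axioms inner_product_module_axioms adj, of x] by simp
qed

lemma nonneg_adjoint_comp_endo: "is_adjoint H H B B' \<Longrightarrow> nonneg (\<lambda>x. B' (B x))"
  by (rule nonneg_adjoint_comp[OF inner_product_module_axioms]) (auto intro: adjoint_comp_not_negative)

end

section \<open>A \<open>C\<^sup>*\<close>-algebra as a module over itself\<close>

definition self_module :: "('a::cstar_algebra, 'a) hmodule" where
  "self_module = \<lparr>act = (*), ip = (\<lambda>x y. star x * y)\<rparr>"

lemma ip_self_module: "ip self_module x y = star x * y"
  by (simp add: self_module_def)

lemma act_self_module: "act self_module x a = x * a"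
  by (simp add: self_module_def)

interpretation self_mod: cauchy_schwarz_module self_module
proof
  fix x :: 'a
  show "norm x = sqrt (norm (ip self_module x x))" by (simp add: ip_self_module cstar_identity)
  show "x = 0" if "ip self_module x x = 0"
    using that cstar_identity[of x] by (simp add: ip_self_module)
next
  fix x y :: 'a
  show "norm (ip self_module x y) \<le> norm x * norm y"
    unfolding ip_self_module by (metis norm_mult_ineq norm_star)
qed (simp_all add: ip_self_module act_self_module mult_scaleC_right star_mult star_star
    algebra_simps)

lemma is_adjoint_mult: "is_adjoint self_module self_module ((*) a) ((*) (star a))"
  by (simp add: is_adjoint_def ip_self_module star_mult mult.assoc)

lemma nonneg_star_mult: "self_mod.nonneg ((*) (star a * a))"
proof -
  have "(*) (star a * a) = (\<lambda>x. star a * (a * x))" by (simp add: fun_eq_iff mult.assoc)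
  then show ?thesis using self_mod.nonneg_adjoint_comp_endo[OF is_adjoint_mult, of a] by simp
qed

text \<open>
  A quasi-inverse \<open>y\<close> of \<open>b = a / c\<close> makes \<open>1 - y\<close> the inverse of \<open>1 - b\<close> in the unitization, which
  acts on the algebra by left multiplication.
\<close>

lemma quasi_invertible_imp_invertible_op:
  assumes "star a = a" "c \<noteq> 0" "quasi_invertible (inverse c *\<^sub>C a)"
  shows "self_mod.invertible_op (\<lambda>x. a * x - c *\<^sub>C x)"
proof -
  define b where "b = inverse c *\<^sub>C a"
  obtain y where y: "b + y - b * y = 0" "b + y - y * b = 0"
    using assms(3) unfolding quasi_invertible_def b_def by blast
  have by_simp: "b * y = b + y" "y * b = b + y" using y by simp_all
  define V where "V x = (- inverse c) *\<^sub>C (x - y * x)" for x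
  have "is_adjoint self_module self_module V (\<lambda>x. cnj (- inverse c) *\<^sub>C (x - star y * x))"
    unfolding V_def
    by (intro is_adjoint_scaleC is_adjoint_diff is_adjoint_ident is_adjoint_mult) unfold_locales
  then have V: "V \<in> adjointable self_module self_module" by (rule adjointableI)
  interpret sc: bounded_linear "\<lambda>x::'a. d *\<^sub>C x" for d by (rule bounded_linear_scaleC)
  have ab: "a = c *\<^sub>C b" using assms(2) by (simp add: b_def scaleC_scaleC scaleC_one)
  have diff: "a * x - c *\<^sub>C x = c *\<^sub>C (b * x - x)" for x
    by (simp add: ab mult_scaleC_left sc.diff)
  have neg: "(- d) *\<^sub>C x = d *\<^sub>C (- x)" for d and x :: 'a
  proof -
    have "(- d) *\<^sub>C x = d *\<^sub>C (complex_of_real (-1) *\<^sub>C x)" by (simp add: scaleC_scaleC)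
    then show ?thesis unfolding scaleC_eq_scaleR by simp
  qed
  have yb: "y * (b * x) = b * x + y * x" and by': "b * (y * x) = b * x + y * x" for x
    by (simp_all add: by_simp distrib_right flip: mult.assoc)
  have "V (a * x - c *\<^sub>C x) = x" for x
  proof -
    have "V (a * x - c *\<^sub>C x) = (- inverse c * c) *\<^sub>C ((b * x - x) - y * (b * x - x))"
      by (simp add: V_def diff mult_scaleC_right sc.diff[symmetric] scaleC_scaleC)
    also have "(b * x - x) - y * (b * x - x) = - x" by (simp add: right_diff_distrib yb)
    finally show ?thesis using assms(2) neg[of 1 "- x"] by (simp add: scaleC_one)
  qed
  moreover have "a * V x - c *\<^sub>C V x = x" for x
  proof -
    have "b * V x - V x = (- inverse c) *\<^sub>C (b * (x - y * x) - (x - y * x))"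
      unfolding V_def mult_scaleC_right by (simp only: sc.diff)
    also have "b * (x - y * x) - (x - y * x) = - x" by (simp add: right_diff_distrib by')
    finally have "b * V x - V x = inverse c *\<^sub>C x" by (simp add: neg)
    then show ?thesis using assms(2) by (simp add: diff scaleC_scaleC scaleC_one)
  qed
  ultimately show ?thesis unfolding self_mod.invertible_op_def using V by blast
qed

lemma cstar_positive_imp_nonneg:
  assumes "cstar_positive a" shows "self_mod.nonneg ((*) a)"
proof (rule self_mod.nonnegI_invertible)
  have sa: "star a = a" and spec: "cstar_spectrum a \<subseteq> \<real>\<^sub>\<ge>\<^sub>0"
    using assms by (auto simp: cstar_positive_def)
  show "self_mod.selfadj ((*) a)" using is_adjoint_mult[of a] by (simp add: sa)
  fix \<epsilon> :: real assume "\<epsilon> > 0"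
  let ?c = "complex_of_real (- \<epsilon>)"
  have "?c \<notin> cstar_spectrum a"
    using spec \<open>\<epsilon> > 0\<close> by (auto simp: subset_eq complex_nonneg_Reals_iff)
  then have "self_mod.invertible_op (\<lambda>x. a * x - ?c *\<^sub>C x)"
    using sa \<open>\<epsilon> > 0\<close> by (intro quasi_invertible_imp_invertible_op) (auto simp: cstar_spectrum_def)
  then show "self_mod.invertible_op (\<lambda>x. a * x + \<epsilon> *\<^sub>R x)" unfolding scaleC_eq_scaleR by simp
qed

text \<open>
  The norm of \<open>a\<close> is that of left multiplication by \<open>a\<close>; it is attained at \<open>star a\<close>.
\<close>

lemma norm_mono_of_nonneg_mult:
  assumes "self_mod.nonneg ((*) a)" "self_mod.nonneg ((*) b)"
  shows "norm a \<le> norm (a + b)"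
proof (cases "a = 0")
  case False
  have "norm (a * star a) \<le> norm (a + b) * norm (star a)"
    by (rule self_mod.nonneg_norm_mono[OF assms]) (simp_all add: norm_mult_ineq flip: distrib_right)
  then show ?thesis using False by (simp add: norm_mult_star norm_star power2_eq_square)
qed simp

section \<open>Hilbert modules: Cauchy-Schwarz and absolute values\<close>

text \<open>
  For \<open>a = \<langle>y, x\<rangle>\<close> and \<open>w = y a\<close> the positive element \<open>\<langle>x - t w, x - t w\<rangle>\<close> is
  \<open>\<langle>x, x\<rangle> - 2 t a\<^sup>* a + t\<^sup>2 a\<^sup>* \<langle>y, y\<rangle> a\<close>, and \<open>2 t a\<^sup>* a\<close> is positive. Hence
  \<open>2 t \<parallel>a\<parallel>\<^sup>2 \<le> \<parallel>x\<parallel>\<^sup>2 + t\<^sup>2 \<parallel>a\<parallel>\<^sup>2 \<parallel>y\<parallel>\<^sup>2\<close> by monotonicity of the norm. The choice \<open>t = 1 / \<parallel>y\<parallel>\<^sup>2\<close> gives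
  the claim.
\<close>

lemma hilbert_module_imp_cauchy_schwarz_module:
  fixes H :: "('h::complex_banach, 'a::cstar_algebra) hmodule"
  assumes "hilbert_module H" shows "cauchy_schwarz_module H"
proof -
  interpret hilbert_module H by fact
  interpret inner_product_module H
    by unfold_locales (fact ip_add_right ip_scaleC_right ip_act_right ip_star ip_definite norm_ip)+
  show ?thesis
  proof
    fix x y :: 'h
    show "norm (ip H x y) \<le> norm x * norm y"
    proof (cases "y = 0")
      case True
      then show ?thesis using ip_scaleR_right[of x 0 0] by simp
    next
      case False
      define a where "a = ip H y x"
      define t where "t = 1 / (norm y)\<^sup>2"
      have t: "t > 0" using False by (simp add: t_def)
      define w where "w = act H y a"
      define p where "p = ip H (x - t *\<^sub>R w) (x - t *\<^sub>R w)"
      define q where "q = (2 * t) *\<^sub>R (star a * a)"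
      have "self_mod.nonneg ((*) p)" unfolding p_def by (rule cstar_positive_imp_nonneg[OF ip_positive])
      moreover have "self_mod.nonneg ((*) q)"
      proof -
        have "(*) q = (\<lambda>x. (2 * t) *\<^sub>R (star a * a * x))" by (simp add: q_def fun_eq_iff)
        then show ?thesis using self_mod.nonneg_scaleR[OF nonneg_star_mult[of a], of "2 * t"] t by simp
      qed
      ultimately have "norm q \<le> norm (p + q)"
        using norm_mono_of_nonneg_mult[of q p] by (simp add: add.commute)
      moreover have "p + q = ip H x x + t\<^sup>2 *\<^sub>R (star a * ip H y y * a)"
      proof -
        have "ip H w x = star a * a" by (simp add: w_def ip_act_left a_def)
        moreover have "ip H x w = star a * a"
          by (simp add: w_def ip_act_right a_def ip_star)
        moreover have "ip H w w = star a * ip H y y * a"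
          by (simp add: w_def ip_act_left ip_act_right mult.assoc)
        moreover have "p = ip H x x - t *\<^sub>R ip H w x - t *\<^sub>R (ip H x w - t *\<^sub>R ip H w w)"
          unfolding p_def ip_diff_left ip_diff_right ip_scaleR_left ip_scaleR_right ..
        moreover have "q = t *\<^sub>R (star a * a) + t *\<^sub>R (star a * a)"
          unfolding q_def by (simp flip: scaleR_add_left)
        ultimately show ?thesis by (simp add: power2_eq_square scaleR_right_diff_distrib)
      qed
      moreover have "norm q = 2 * t * (norm a)\<^sup>2" using t by (simp add: q_def cstar_identity)
      moreover have "norm (ip H x x + t\<^sup>2 *\<^sub>R (star a * ip H y y * a)) \<le> (norm x)\<^sup>2 + t * (norm a)\<^sup>2"
      proof -
        have "norm (star a * ip H y y * a) \<le> norm (star a * ip H y y) * norm a"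
          by (rule norm_mult_ineq)
        also have "\<dots> \<le> norm a * (norm y)\<^sup>2 * norm a"
          using norm_mult_ineq[of "star a" "ip H y y"]
          by (intro mult_right_mono) (simp_all add: norm_star norm_ip_self)
        finally have "t\<^sup>2 * norm (star a * ip H y y * a) \<le> t\<^sup>2 * (norm a * (norm y)\<^sup>2 * norm a)"
          by (intro mult_left_mono) auto
        also have "\<dots> = t * (norm a)\<^sup>2" using False by (simp add: t_def power2_eq_square)
        finally show ?thesis
          using norm_triangle_ineq[of "ip H x x" "t\<^sup>2 *\<^sub>R (star a * ip H y y * a)"]
          by (simp add: norm_ip_self)
      qed
      ultimately have "t * (norm a)\<^sup>2 \<le> (norm x)\<^sup>2" by simp
      then have "(norm a)\<^sup>2 \<le> (norm x * norm y)\<^sup>2"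
        using False by (simp add: t_def power_mult_distrib field_simps)
      then have "norm a \<le> norm x * norm y" by (rule power2_le_imp_le) simp
      moreover have "norm (ip H x y) = norm a" by (metis a_def ip_star norm_star)
      ultimately show ?thesis by simp
    qed
  qed
qed

context hilbert_module
begin

sublocale cauchy_schwarz_module H
  by (rule hilbert_module_imp_cauchy_schwarz_module) unfold_locales

lemma ip_self_add_eq_0D:
  assumes "ip H x x + ip H y y = 0" shows "x = 0"
proof -
  have "norm (ip H x x) \<le> norm (ip H x x + ip H y y)"
    by (intro norm_mono_of_nonneg_mult cstar_positive_imp_nonneg ip_positive)
  then show ?thesis using assms ip_definite by simp
qed

end

lemma nonneg_adjoint_comp_hilbert:
  assumes "hilbert_module H" "hilbert_module K" and adj: "is_adjoint H K B B'"
  shows "cauchy_schwarz_module.nonneg H (\<lambda>x. B' (B x))"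
proof -
  interpret H: hilbert_module H by fact
  interpret K: hilbert_module K by fact
  show ?thesis
  proof (rule H.nonneg_adjoint_comp[OF K.inner_product_module_axioms adj])
    fix D D' G x
    assume D: "is_adjoint H K D D'" and G: "H.selfadj G" and neg: "\<And>x. D' (D x) = - G (G x)"
    have "ip K (D x) (D x) + ip H (G x) (G x) = 0"
    proof -
      have "ip K (D x) (D x) + ip H (G x) (G x) = ip H x (D' (D x)) + ip H x (G (G x))"
        using D G by (metis is_adjoint_def)
      also have "\<dots> = ip H x (D' (D x) + G (G x))" by (simp only: H.ip_add_right)
      also have "\<dots> = 0" using H.ip_scaleR_right[of x 0 0] by (simp add: neg)
      finally show ?thesis .
    qed
    moreover have "norm (ip K (D x) (D x)) \<le> norm (ip K (D x) (D x) + ip H (G x) (G x))"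
      by (intro norm_mono_of_nonneg_mult cstar_positive_imp_nonneg H.ip_positive K.ip_positive)
    ultimately show "D x = 0" using K.ip_definite by simp
  qed
qed

context hilbert_module
begin

text \<open>
  For the commuting roots \<open>R\<close> and \<open>W\<close> and \<open>D = R - W\<close> one has \<open>(R + W) D = R\<^sup>2 - W\<^sup>2 = 0\<close>. With
  \<open>R = r\<^sup>2\<close> and \<open>W = w\<^sup>2\<close> this makes \<open>\<langle>r D x, r D x\<rangle> + \<langle>w D x, w D x\<rangle>\<close> vanish, so both terms do,
  hence \<open>R D = W D = 0\<close> and \<open>D\<^sup>2 = 0\<close>.
\<close>

lemma nonneg_sqrt_unique:
  assumes R: "nonneg R" and W: "nonneg W" and comm: "commutant (\<lambda>x. R (R x)) \<subseteq> commutant W"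
    and eq: "\<And>x. W (W x) = R (R x)"
  shows "R = W"
proof -
  note linR = bounded_linear.linear[OF selfadj_bounded_linear[OF nonneg_selfadj[OF R]]]
  note linW = bounded_linear.linear[OF selfadj_bounded_linear[OF nonneg_selfadj[OF W]]]
  have "R \<in> commutant W" using comm commutantI[OF nonneg_selfadj[OF R], of "\<lambda>x. R (R x)"] by blast
  then have RW: "R (W x) = W (R x)" for x by (rule commutantD)
  obtain r where r: "nonneg r" "\<And>x. r (r x) = R x" by (rule nonneg_sqrt[OF R]) blast
  obtain w where w: "nonneg w" "\<And>x. w (w x) = W x" by (rule nonneg_sqrt[OF W]) blast
  define D where "D x = R x - W x" for x
  have D: "selfadj D"
    unfolding D_def by (intro selfadj_diff nonneg_selfadj R W)
  have kill: "R (D x) = 0" "W (D x) = 0" for x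
  proof -
    have sum0: "R (D x) + W (D x) = 0"
      by (simp add: D_def linear_diff[OF linR] linear_diff[OF linW] RW eq)
    have "ip H (r (D x)) (r (D x)) + ip H (w (D x)) (w (D x)) = ip H (D x) (R (D x) + W (D x))"
      using nonneg_selfadj[OF r(1)] nonneg_selfadj[OF w(1)]
      by (simp add: is_adjoint_def r(2) w(2) ip_add_right)
    also have "\<dots> = 0" using sum0 ip_scaleR_right[of "D x" 0 0] by simp
    finally have "r (D x) = 0" by (rule ip_self_add_eq_0D)
    then have "R (D x) = r 0" by (metis r(2))
    then show "R (D x) = 0"
      using linear_0[OF bounded_linear.linear[OF selfadj_bounded_linear[OF nonneg_selfadj[OF r(1)]]]] by simp
    then show "W (D x) = 0" using sum0 by simp
  qed
  have "D x = 0" for x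
  proof -
    have "D (D x) = 0" using kill by (simp add: D_def[of "D x"])
    then show ?thesis using selfadj_norm_sq_le[OF D, of x] by simp
  qed
  then show ?thesis by (auto simp: D_def fun_eq_iff)
qed

lemma op_sqrt_eq:
  assumes "nonneg R" shows "op_sqrt H (\<lambda>x. R (R x)) = R"
proof -
  obtain W where W: "nonneg W" "\<And>x. W (W x) = R (R x)" "commutant (\<lambda>x. R (R x)) \<subseteq> commutant W"
    by (rule nonneg_sqrt[OF nonneg_square[OF nonneg_selfadj[OF assms]]]) blast
  have unique: "R' = W" if "nonneg R'" "\<And>x. R' (R' x) = R (R x)" for R'
    using W by (intro nonneg_sqrt_unique that(1)) (simp_all add: that(2))
  show ?thesis
    unfolding op_sqrt_def op_positive_iff_nonneg
  proof (rule the_equality)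
    show "nonneg R \<and> R \<circ> R = (\<lambda>x. R (R x))" using assms by (simp add: comp_def)
    show "R' = R" if "nonneg R' \<and> R' \<circ> R' = (\<lambda>x. R (R x))" for R'
      using unique[of R'] unique[of R] that assms by (metis comp_apply)
  qed
qed

end

lemma op_abs_eqI:
  assumes "hilbert_module H" "is_adjoint H K B B'" "cauchy_schwarz_module.nonneg H R" "\<And>x. R (R x) = B' (B x)"
  shows "op_abs H K B = R"
proof -
  interpret H: hilbert_module H by fact
  have "adj H K B \<circ> B = (\<lambda>x. R (R x))"
    by (simp add: adj_eq[OF H.inner_product_module_axioms assms(2)] fun_eq_iff assms(4))
  then show ?thesis unfolding op_abs_def using H.op_sqrt_eq[OF assms(3)] by simp
qed

lemma op_abs_properties:
  assumes "hilbert_module H" "hilbert_module K" "is_adjoint H K B B'"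
  shows nonneg_op_abs: "cauchy_schwarz_module.nonneg H (op_abs H K B)"
    and op_abs_square: "op_abs H K B (op_abs H K B x) = B' (B x)"
proof -
  interpret H: hilbert_module H by fact
  obtain W where "H.nonneg W" "\<And>x. W (W x) = B' (B x)"
    by (rule H.nonneg_sqrt[OF nonneg_adjoint_comp_hilbert[OF assms]]) blast
  moreover from this have "op_abs H K B = W" by (rule op_abs_eqI[OF assms(1,3)])
  ultimately show "H.nonneg (op_abs H K B)" "op_abs H K B (op_abs H K B x) = B' (B x)" by simp_all
qed

section \<open>Projections and polar decompositions\<close>

context hilbert_module
begin

lemma projection_range:
  assumes "\<And>x. E (E x) = E x" shows "range E = {x. E x = x}"
  using assms by (auto simp: image_iff) (metis)

lemma projection_range_closed:
  assumes E: "selfadj E" "\<And>x. E (E x) = E x" shows "closed (range E)"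
proof -
  have "continuous_on UNIV E"
    using selfadj_bounded_linear[OF E(1)] by (simp add: linear_continuous_on)
  then show ?thesis
    unfolding projection_range[OF E(2)] by (intro closed_Collect_eq continuous_on_id)
qed

lemma proj_eqI:
  assumes "y \<in> M" "x - y \<in> orth_compl H M"
  shows "proj H M x = y"
  unfolding proj_def
proof (rule the_equality)
  fix z assume "z \<in> M \<and> x - z \<in> orth_compl H M"
  then have "ip H (x - z) (y - z) = 0" "ip H (x - y) (y - z) = 0"
    using assms by (simp_all add: orth_compl_def ip_diff_right)
  then have "ip H ((x - z) - (x - y)) (y - z) = 0" unfolding ip_diff_left[of "x - z"] by simp
  then show "z = y" using ip_definite[of "y - z"] by simp
qed (use assms in auto)

lemma orthogonally_complemented_projection_range:
  assumes E: "selfadj E" "\<And>x. E (E x) = E x"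
  shows "orthogonally_complemented H (range E)" and "proj H (range E) = E"
proof -
  note ipm = inner_product_module_axioms inner_product_module_axioms
  have orth: "x - E x \<in> orth_compl H (range E)" for x
  proof -
    have "ip H (x - E x) (E y) = ip H (E x - E (E x)) y" for y
      using E(1) by (metis ip_diff_left is_adjoint_def)
    then show ?thesis using ip_scaleR_left[of 0 0] by (auto simp: orth_compl_def E(2))
  qed
  show "proj H (range E) = E" by (intro ext proj_eqI orth) auto
  have "E 0 = 0" using linear_0[OF bounded_linear.linear[OF selfadj_bounded_linear[OF E(1)]]] .
  then have "closed_submodule H (range E)"
    using projection_range_closed[OF E] unfolding closed_submodule_def projection_range[OF E(2)]
    by (simp add: is_adjoint_additive[OF ipm E(1)] is_adjoint_scaleC_commute[OF ipm E(1)]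
        is_adjoint_act[OF ipm E(1)])
  moreover have "range E \<inter> orth_compl H (range E) = {0}"
  proof -
    have "x = 0" if "x \<in> range E" "x \<in> orth_compl H (range E)" for x
      using that ip_definite[of x] unfolding orth_compl_def by blast
    moreover have "0 \<in> range E" using \<open>E 0 = 0\<close> by (metis rangeI)
    moreover have "0 \<in> orth_compl H (range E)" using orth[of 0] \<open>E 0 = 0\<close> by simp
    ultimately show ?thesis by blast
  qed
  moreover have "\<exists>y\<in>range E. \<exists>z\<in>orth_compl H (range E). x = y + z" for x
    using orth[of x] by (intro bexI[of _ "E x"] bexI[of _ "x - E x"]) auto
  ultimately show "orthogonally_complemented H (range E)"
    unfolding orthogonally_complemented_def by blast
qed

lemma proj_range:
  assumes "orthogonally_complemented H M" shows "range (proj H M) = M"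
proof -
  have "proj H M x \<in> M" for x
  proof -
    obtain y z where "y \<in> M" "z \<in> orth_compl H M" "x = y + z"
      using assms unfolding orthogonally_complemented_def by metis
    then show ?thesis using proj_eqI[of y M x] by simp
  qed
  moreover have "proj H M y = y" if "y \<in> M" for y
    using that ip_scaleR_left[of 0 0] by (intro proj_eqI) (auto simp: orth_compl_def)
  ultimately show ?thesis by (metis image_subset_iff rangeI subsetI subset_antisym)
qed

end

text \<open>
  A polar decomposition with the adjoints and the absolute value as parameters, so that another
  one can be exhibited by naming them. That \<open>U\<close> is a partial isometry is expressed by
  \<open>U U\<^sup>* U = U\<close>.
\<close>

locale polar_data = H: hilbert_module H + K: hilbert_module K
  for H :: "('h::complex_banach, 'a::cstar_algebra) hmodule"
    and K :: "('k::complex_banach, 'a) hmodule" +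
  fixes B :: "'h \<Rightarrow> 'k" and B' :: "'k \<Rightarrow> 'h" and U :: "'h \<Rightarrow> 'k" and U' :: "'k \<Rightarrow> 'h" and R :: "'h \<Rightarrow> 'h"
  assumes adj_B: "is_adjoint H K B B'"
    and adj_U: "is_adjoint H K U U'"
    and nonneg_R: "H.nonneg R"
    and R_square: "R (R x) = B' (B x)"
    and B_eq: "B x = U (R x)"
    and U_U'_U: "U (U' (U x)) = U x"
    and range_U'_U: "range (\<lambda>x. U' (U x)) = closure (range B')"
begin

lemma adj_U': "is_adjoint K H U' U"
  by (rule is_adjoint_sym[OF H.inner_product_module_axioms K.inner_product_module_axioms adj_U])

lemma adj_B': "is_adjoint K H B' B"
  by (rule is_adjoint_sym[OF H.inner_product_module_axioms K.inner_product_module_axioms adj_B])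

lemma selfadj_R: "H.selfadj R"
  by (rule H.nonneg_selfadj[OF nonneg_R])

lemma selfadj_U'_U: "H.selfadj (\<lambda>x. U' (U x))"
  by (rule is_adjoint_comp[OF adj_U' adj_U])

lemma U'_U_U': "U' (U (U' x)) = U' x"
proof -
  have "(\<lambda>x. U' (U (U' x))) = U'"
  proof (rule is_adjoint_unique[OF H.inner_product_module_axioms _ adj_U])
    show "is_adjoint H K U (\<lambda>x. U' (U (U' x)))"
      using is_adjoint_comp[OF is_adjoint_comp[OF adj_U adj_U'] adj_U] by (simp add: U_U'_U)
  qed
  then show ?thesis by (rule fun_cong)
qed

lemma B'_eq: "B' y = R (U' y)"
proof -
  have "B' = (\<lambda>y. R (U' y))"
  proof (rule is_adjoint_unique[OF H.inner_product_module_axioms adj_B])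
    show "is_adjoint H K B (\<lambda>y. R (U' y))"
      using is_adjoint_comp[OF adj_U selfadj_R] by (simp flip: B_eq)
  qed
  then show ?thesis by (rule fun_cong)
qed

lemma U'_U_fix: "x \<in> closure (range B') \<Longrightarrow> U' (U x) = x"
  unfolding range_U'_U[symmetric] by (auto simp: U_U'_U)

lemma U'_U_B': "U' (U (B' y)) = B' y"
  by (rule U'_U_fix) (simp add: closure_def)

text \<open>
  On the complement of the closure of the range of \<open>B\<^sup>*\<close> the operator \<open>B\<close> vanishes, so \<open>R\<close> does too,
  because \<open>R\<^sup>2 = B\<^sup>* B\<close>.
\<close>

lemma R_U'_U: "R (U' (U x)) = R x"
proof -
  have linR: "linear R" using H.selfadj_bounded_linear[OF selfadj_R] by (rule bounded_linear.linear)
  have linB: "linear B" "linear B'"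
    using is_adjoint_bounded_linear[OF H.cauchy_schwarz_module_axioms K.cauchy_schwarz_module_axioms adj_B]
      is_adjoint_bounded_linear[OF K.cauchy_schwarz_module_axioms H.cauchy_schwarz_module_axioms adj_B']
    by (auto intro: bounded_linear.linear)
  define d where "d = x - U' (U x)"
  have "B x = B (U' (U x))"
  proof (rule K.ip_right_eqI)
    fix y
    have "ip K y (B x) = ip H (U' (U (B' y))) x"
      using adj_B' by (simp add: is_adjoint_def U'_U_B')
    also have "\<dots> = ip H (B' y) (U' (U x))" using selfadj_U'_U by (simp add: is_adjoint_def)
    also have "\<dots> = ip K y (B (U' (U x)))" using adj_B' by (simp add: is_adjoint_def)
    finally show "ip K y (B x) = ip K y (B (U' (U x)))" .
  qed
  then have "R (R d) = 0" by (simp add: R_square d_def linear_diff[OF linB(1)] linear_0[OF linB(2)])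
  then have "R d = 0" using H.selfadj_norm_sq_le[OF selfadj_R, of d] by simp
  then show ?thesis by (simp add: d_def linear_diff[OF linR])
qed

lemma U'_U_R: "U' (U (R x)) = R x"
proof (rule H.ip_right_eqI)
  fix y
  have "ip H y (U' (U (R x))) = ip H (R (U' (U y))) x"
    using selfadj_U'_U selfadj_R by (simp add: is_adjoint_def)
  then show "ip H y (U' (U (R x))) = ip H y (R x)"
    using selfadj_R by (simp add: R_U'_U) (simp add: is_adjoint_def)
qed

lemma op_abs_eq: "op_abs H K B = R"
  by (rule op_abs_eqI[OF H.hilbert_module_axioms adj_B nonneg_R R_square])

lemma adj_U_eq: "adj H K U = U'"
  by (rule adj_eq[OF H.inner_product_module_axioms adj_U])

lemma polar_decomposition: "polar_decomposition H K B U"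
proof -
  note E = H.orthogonally_complemented_projection_range[OF selfadj_U'_U U'_U_U'[of "U _"]]
  have adjB: "adj H K B = B'" by (rule adj_eq[OF H.inner_product_module_axioms adj_B])
  have comp: "U' \<circ> U = (\<lambda>x. U' (U x))" by (simp add: comp_def)
  have "is_projection H (U' \<circ> U)"
    unfolding is_projection_def comp
    using adjointableI[OF selfadj_U'_U] adj_eq[OF H.inner_product_module_axioms selfadj_U'_U]
    by (simp add: comp_def U_U'_U)
  then show ?thesis
    unfolding polar_decomposition_def partial_isometry_def adj_U_eq op_abs_eq adjB
    using E adjointableI[OF adj_B] adjointableI[OF adj_U]
    by (simp add: comp_def B_eq[abs_def] range_U'_U)
qed

end

lemma polar_decomposition_data:
  assumes H: "hilbert_module H" and K: "hilbert_module K" and pd: "polar_decomposition H K B U"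
  shows "polar_data H K B (adj H K B) U (adj H K U) (op_abs H K B)"
proof -
  interpret H: hilbert_module H by fact
  interpret K: hilbert_module K by fact
  note ipmH = H.inner_product_module_axioms
  have B: "is_adjoint H K B (adj H K B)" and U: "is_adjoint H K U (adj H K U)"
    using pd unfolding polar_decomposition_def partial_isometry_def
    by (simp_all add: is_adjoint_adj[OF ipmH])
  let ?P = "\<lambda>x. adj H K U (U x)"
  have idem: "?P (?P x) = ?P x" for x
    using pd unfolding polar_decomposition_def partial_isometry_def is_projection_def
    by (metis comp_apply)
  have U': "is_adjoint K H (adj H K U) U"
    by (rule is_adjoint_sym[OF ipmH K.inner_product_module_axioms U])
  have linU: "linear U" "linear (adj H K U)"
    using is_adjoint_bounded_linear[OF H.cauchy_schwarz_module_axioms K.cauchy_schwarz_module_axioms U]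
      is_adjoint_bounded_linear[OF K.cauchy_schwarz_module_axioms H.cauchy_schwarz_module_axioms U']
    by (auto intro: bounded_linear.linear)
  show ?thesis
  proof
    show "H.nonneg (op_abs H K B)" by (rule nonneg_op_abs[OF H K B])
    show "op_abs H K B (op_abs H K B x) = adj H K B (B x)" for x by (rule op_abs_square[OF H K B])
    show "B x = U (op_abs H K B x)" for x
      using pd unfolding polar_decomposition_def by (metis comp_apply)
    show "U (?P x) = U x" for x
    proof -
      have "?P (x - ?P x) = 0"
        by (simp add: linear_diff[OF linU(1)] linear_diff[OF linU(2)] idem)
      then have "U (x - ?P x) = 0"
        using is_adjoint_norm_sq_le[OF H.cauchy_schwarz_module_axioms K.inner_product_module_axioms U, of "x - ?P x"]
        by simp
      then show ?thesis by (simp add: linear_diff[OF linU(1)])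
    qed
    have "?P = proj H (closure (range (adj H K B)))"
      and "orthogonally_complemented H (closure (range (adj H K B)))"
      using pd unfolding polar_decomposition_def by (simp_all add: comp_def)
    then show "range ?P = closure (range (adj H K B))" using H.proj_range by metis
  qed (fact B U)+
qed

text \<open>
  Two operators that determine each other by \<open>B = V\<^sub>1 C V\<^sub>2\<close> and \<open>C = V\<^sub>1\<^sup>* B V\<^sub>2\<^sup>*\<close> have polar
  decompositions that do so as well. The projections \<open>V\<^sub>1 V\<^sub>1\<^sup>*\<close> and \<open>V\<^sub>2\<^sup>* V\<^sub>2\<close> fix the ranges of \<open>B\<close>
  and \<open>B\<^sup>*\<close>; by continuity the latter fixes the range of \<open>U\<^sup>* U\<close>, therefore those of \<open>U\<^sup>*\<close> and \<open>R\<close>, and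
  the former fixes the range of \<open>U = U U\<^sup>* U\<close>. With these absorption rules every identity required of
  \<open>V\<^sub>1\<^sup>* U V\<^sub>2\<^sup>*\<close> and \<open>V\<^sub>2 R V\<^sub>2\<^sup>*\<close> reduces to the one for \<open>U\<close> and \<open>R\<close>.
\<close>

lemma (in polar_data) transfer:
  assumes V1: "is_adjoint K K V1 V1'" "\<And>x. V1 (V1' (V1 x)) = V1 x" "\<And>x. V1' (V1 (V1' x)) = V1' x"
    and V2: "is_adjoint H H V2 V2'" "\<And>x. V2 (V2' (V2 x)) = V2 x" "\<And>x. V2' (V2 (V2' x)) = V2' x"
    and C: "is_adjoint H K C C'"
    and B_C: "\<And>x. B x = V1 (C (V2 x))" and C_B: "\<And>x. C x = V1' (B (V2' x))"
  shows "polar_data H K C C' (\<lambda>x. V1' (U (V2' x))) (\<lambda>x. V2 (U' (V1 x))) (\<lambda>x. V2 (R (V2' x)))"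
proof -
  note ipmH = H.inner_product_module_axioms and ipmK = K.inner_product_module_axioms
  note V1' = is_adjoint_sym[OF ipmK ipmK V1(1)]
  note V2' = is_adjoint_sym[OF ipmH ipmH V2(1)]
  have cont: "continuous_on UNIV f"
    if "is_adjoint M N f f'" "cauchy_schwarz_module M" "cauchy_schwarz_module N"
    for M :: "('x::complex_banach, 'a) hmodule" and N :: "('y::complex_banach, 'a) hmodule" and f f'
    using is_adjoint_bounded_linear[OF that(2,3,1)] by (simp add: linear_continuous_on)
  have C': "C' y = V2 (B' (V1 y))" for y
  proof -
    have "is_adjoint H K C (\<lambda>y. V2 (B' (V1 y)))"
      using is_adjoint_comp[OF V1' is_adjoint_comp[OF adj_B V2']] by (simp flip: C_B)
    from is_adjoint_unique[OF ipmH C this] show ?thesis by (rule fun_cong)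
  qed
  have B': "B' y = V2' (C' (V1' y))" for y
  proof -
    have "is_adjoint H K B (\<lambda>y. V2' (C' (V1' y)))"
      using is_adjoint_comp[OF V1(1) is_adjoint_comp[OF C V2(1)]] by (simp flip: B_C)
    from is_adjoint_unique[OF ipmH adj_B this] show ?thesis by (rule fun_cong)
  qed
  have V1_B: "V1 (V1' (B x)) = B x" for x by (simp add: B_C V1)
  have V2_B': "V2' (V2 (B' y)) = B' y" for y by (simp add: B' V2)
  have B'_V1: "B' (V1 (V1' y)) = B' y" for y by (simp add: B' V1)
  have V2_fix: "V2' (V2 z) = z" if "z \<in> closure (range B')" for z
  proof -
    have "closed {z. V2' (V2 z) = z}"
      using cont[OF is_adjoint_comp[OF V2' V2(1)] H.cauchy_schwarz_module_axioms H.cauchy_schwarz_module_axioms]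
      by (intro closed_Collect_eq continuous_on_id)
    then have "closure (range B') \<subseteq> {z. V2' (V2 z) = z}" by (rule closure_minimal[rotated]) (auto simp: V2_B')
    then show ?thesis using that by blast
  qed
  have P_in: "U' (U x) \<in> closure (range B')" for x
    unfolding range_U'_U[symmetric] by blast
  have V2_U': "V2' (V2 (U' y)) = U' y" for y
    using V2_fix[OF P_in[of "U' y"]] by (simp add: U'_U_U')
  have V2_R: "V2' (V2 (R x)) = R x" for x
    using V2_fix[OF P_in[of "R x"]] by (simp add: U'_U_R)
  have V1_U: "V1 (V1' (U x)) = U x" for x
  proof -
    have "closed {z. V1 (V1' (U z)) = U z}"
      using cont[OF is_adjoint_comp[OF is_adjoint_comp[OF V1(1) V1'] adj_U] H.cauchy_schwarz_module_axioms K.cauchy_schwarz_module_axioms]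
        cont[OF adj_U H.cauchy_schwarz_module_axioms K.cauchy_schwarz_module_axioms]
      by (intro closed_Collect_eq)
    then have "closure (range B') \<subseteq> {z. V1 (V1' (U z)) = U z}"
      by (rule closure_minimal[rotated]) (auto simp: B'_eq V1_B simp flip: B_eq)
    then have "V1 (V1' (U (U' (U x)))) = U (U' (U x))" using P_in[of x] by blast
    then show ?thesis by (simp add: U_U'_U)
  qed
  let ?E = "\<lambda>x. V2 (U' (U (V2' x)))"
  have adj_W: "is_adjoint H K (\<lambda>x. V1' (U (V2' x))) (\<lambda>x. V2 (U' (V1 x)))"
    by (rule is_adjoint_comp[OF V1' is_adjoint_comp[OF adj_U V2']])
  show ?thesis
  proof
    show "is_adjoint H K C C'" by fact
    show "is_adjoint H K (\<lambda>x. V1' (U (V2' x))) (\<lambda>x. V2 (U' (V1 x)))" by (rule adj_W)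
    obtain g where g: "H.nonneg g" "\<And>x. g (g x) = R x" by (rule H.nonneg_sqrt[OF nonneg_R]) blast
    show "H.nonneg (\<lambda>x. V2 (R (V2' x)))"
      using H.nonneg_adjoint_comp_endo[OF is_adjoint_comp[OF H.nonneg_selfadj[OF g(1)] V2']]
      by (simp add: g(2))
    show "V2 (R (V2' (V2 (R (V2' x))))) = C' (C x)" for x
      by (simp add: V2_R R_square C_B C' V1_B)
    show "C x = V1' (U (V2' (V2 (R (V2' x)))))" for x
      by (simp add: V2_R C_B B_eq)
    show "V1' (U (V2' (V2 (U' (V1 (V1' (U (V2' x)))))))) = V1' (U (V2' x))" for x
      by (simp add: V1_U V2_U' U_U'_U)
    show "range (\<lambda>x. V2 (U' (V1 (V1' (U (V2' x)))))) = closure (range C')"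
      unfolding V1_U
    proof (rule subset_antisym)
      have "V2 ` closure (range B') \<subseteq> closure (range C')"
      proof (rule image_closure_subset)
        show "continuous_on (closure (range B')) V2"
          using cont[OF V2(1) H.cauchy_schwarz_module_axioms H.cauchy_schwarz_module_axioms] by (rule continuous_on_subset) simp
        have "V2 (B' y) = C' (V1' y)" for y by (simp add: C' B'_V1)
        then show "V2 ` range B' \<subseteq> closure (range C')"
          using closure_subset[of "range C'"] by auto
      qed simp
      then show "range ?E \<subseteq> closure (range C')" using P_in by blast
    next
      have E: "H.selfadj ?E" "?E (?E x) = ?E x" for x
        using is_adjoint_comp[OF V2(1) is_adjoint_comp[OF selfadj_U'_U V2']]
        by (simp_all add: V2_U' U_U'_U)
      have "range C' \<subseteq> range ?E"
      proof
        fix z assume "z \<in> range C'"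
        then obtain y where "z = V2 (B' (V1 y))" by (auto simp: C')
        then have "?E z = z" by (simp add: V2_B' U'_U_B')
        then show "z \<in> range ?E" by (metis rangeI)
      qed
      then show "closure (range C') \<subseteq> range ?E"
        by (rule closure_minimal) (rule H.projection_range_closed[OF E])
    qed
  qed
qed

text \<open>
  The square of \<open>U R U\<^sup>*\<close> is \<open>U R\<^sup>2 U\<^sup>* = (U R) (U R)\<^sup>* = B B\<^sup>*\<close>.
\<close>

lemma (in polar_data) op_abs_adjoint:
  shows "op_abs K H B' = (\<lambda>x. U (R (U' x)))"
proof (rule op_abs_eqI[OF K.hilbert_module_axioms adj_B'])
  obtain g where g: "H.nonneg g" "\<And>x. g (g x) = R x" by (rule H.nonneg_sqrt[OF nonneg_R]) blast
  show "K.nonneg (\<lambda>x. U (R (U' x)))"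
    using nonneg_adjoint_comp_hilbert[OF K.hilbert_module_axioms H.hilbert_module_axioms
        is_adjoint_comp[OF H.nonneg_selfadj[OF g(1)] adj_U']]
    by (simp add: g(2))
  show "U (R (U' (U (R (U' x))))) = B (B' x)" for x
    by (simp add: U'_U_R B_eq B'_eq)
qed

theorem theorem2p4:
  fixes H :: "('h::complex_banach, 'a::cstar_algebra) hmodule"
    and K :: "('k::complex_banach, 'a) hmodule"
    and T UT :: "'k \<Rightarrow> 'k" and S US :: "'h \<Rightarrow> 'h" and A :: "'h \<Rightarrow> 'k"
  assumes "hilbert_module H" and "hilbert_module K"
    and "T \<in> adjointable K K" and "S \<in> adjointable H H"
    and "polar_decomposition K K T UT" and "polar_decomposition H H S US"
    and "A \<in> adjointable H K"
  shows
    "let X = T \<circ> A \<circ> S;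
         Y = op_abs K K T \<circ> A \<circ> op_abs H H (adj H H S)
     in X \<in> adjointable H K \<and> Y \<in> adjointable H K
      \<and> (\<forall>UX. polar_decomposition H K X UX \<longrightarrow>
           polar_decomposition H K Y (adj K K UT \<circ> UX \<circ> adj H H US))
      \<and> (\<forall>UY. polar_decomposition H K Y UY \<longrightarrow>
           polar_decomposition H K X (UT \<circ> UY \<circ> US))"
proof -
  interpret H: hilbert_module H by fact
  interpret K: hilbert_module K by fact
  interpret T: polar_data K K T "adj K K T" UT "adj K K UT" "op_abs K K T"
    by (rule polar_decomposition_data) fact+
  interpret S: polar_data H H S "adj H H S" US "adj H H US" "op_abs H H S"
    by (rule polar_decomposition_data) fact+
  let ?A' = "adj H K A" and ?RT = "op_abs K K T" and ?RS = "op_abs H H (adj H H S)"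
  let ?UT' = "adj K K UT" and ?US' = "adj H H US"
  define X where "X = T \<circ> A \<circ> S"
  define Y where "Y = ?RT \<circ> A \<circ> ?RS"
  have A: "is_adjoint H K A ?A'" by (rule is_adjoint_adj[OF H.inner_product_module_axioms assms(7)])
  have RS: "?RS x = US (op_abs H H S (?US' x))" for x
    using S.op_abs_adjoint by simp
  have RS_selfadj: "H.selfadj ?RS"
    by (rule H.nonneg_selfadj[OF nonneg_op_abs[OF assms(1,1) S.adj_B']])
  have X: "is_adjoint H K X (\<lambda>y. adj H H S (?A' (adj K K T y)))"
    using is_adjoint_comp[OF T.adj_B is_adjoint_comp[OF A S.adj_B]] by (simp add: X_def comp_def)
  have Y: "is_adjoint H K Y (\<lambda>y. ?RS (?A' (?RT y)))"
    using is_adjoint_comp[OF T.selfadj_R is_adjoint_comp[OF A RS_selfadj]] by (simp add: Y_def comp_def)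
  have X_Y: "X x = UT (Y (US x))" for x
    by (simp add: X_def Y_def RS T.B_eq S.B_eq S.R_U'_U)
  have Y_X: "Y x = ?UT' (X (?US' x))" for x
    by (simp add: X_def Y_def RS T.B_eq S.B_eq T.U'_U_R)
  have "polar_decomposition H K Y (?UT' \<circ> UX \<circ> ?US')" if "polar_decomposition H K X UX" for UX
  proof -
    interpret X: polar_data H K X "adj H K X" UX "adj H K UX" "op_abs H K X"
      by (rule polar_decomposition_data[OF assms(1,2) that])
    show ?thesis
      using polar_data.polar_decomposition[OF X.transfer[OF T.adj_U T.U_U'_U T.U'_U_U'
            S.adj_U S.U_U'_U S.U'_U_U' Y X_Y Y_X]]
      by (simp add: comp_def)
  qed
  moreover have "polar_decomposition H K X (UT \<circ> UY \<circ> US)" if "polar_decomposition H K Y UY" for UY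
  proof -
    interpret Y: polar_data H K Y "adj H K Y" UY "adj H K UY" "op_abs H K Y"
      by (rule polar_decomposition_data[OF assms(1,2) that])
    show ?thesis
      using polar_data.polar_decomposition[OF Y.transfer[OF T.adj_U' T.U'_U_U' T.U_U'_U
            S.adj_U' S.U'_U_U' S.U_U'_U X Y_X X_Y]]
      by (simp add: comp_def)
  qed
  ultimately show ?thesis
    using adjointableI[OF X] adjointableI[OF Y] by (simp add: Let_def X_def Y_def)
qed

end
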